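(* Let $s, t \geq 2$ be integers. Every $K^{\ast}_{s,t}$-minor-free graph $G$ is isomorphic to a subgraph of $H \boxtimes P \boxtimes K_m$ for some path $P$ and some graph $H$ with $\mathrm{tw}(H) \leq s$, where $m := (t-1)\,\mathrm{ltw}(G)$.
   Context: All graphs are finite, simple and undirected. $\mathrm{tw}$ denotes treewidth. $K^{\ast}_{s,t}$ is the graph whose vertex-set is partitioned into $A \cup B$ with $|A| = s$, $|B| = t$, $A$ a clique, $B$ an independent set, and every vertex of $A$ adjacent to every vertex of $B$. A layering of $G$ is a partition $(V_1, V_2, \dots)$ of $V(G)$ such that for each edge $vw$ with $v \in V_i$, $w \in V_j$ we have $|i-j| \leq 1$. The layered treewidth $\mathrm{ltw}(G)$ is the minimum integer $k$ such that $G$ has a layering $\mathcal{L}$ and a tree-decomposition $(T,\mathcal{W})$ with $|L \cap W| \leq k$ for every layer $L$ and every bag $W$. The strong product $A \boxtimes B$ has vertex-set $V(A)\times V(B)$, where distinct $(v,x),(w,y)$ are adjacent if ($v=w$ and $xy\in E(B)$), or ($x=y$ and $vw\in E(A)$), or ($vw\in E(A)$ and $xy\in E(B)$). $K_m$ is the complete graph on $m$ vertices. *)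

theory Defs
  imports
    "Graph_Theory.Digraph_Component"
    "Graph_Theory.Digraph_Isomorphism"
    "HOL-Library.Disjoint_Sets"
begin

text \<open>
  Finite simple undirected graphs are finite, loop-free digraphs with a symmetric set of pairs as
  arcs, i.e. \<^const>\<open>pair_graph\<close> of \<^typ>\<open>'a pair_pre_digraph\<close>; the null graph is allowed.
\<close>

subsection \<open>Subgraphs and minors\<close>

definition iso_to_subgraph :: "'a pair_pre_digraph \<Rightarrow> 'b pair_pre_digraph \<Rightarrow> bool" where
  "iso_to_subgraph G X \<longleftrightarrow>
     (\<exists>G'. pair_graph G' \<and> subgraph (with_proj G') (with_proj X) \<and>
           digraph_iso (with_proj G) (with_proj G'))"

text \<open>
  The vertex arising from the contraction of the edge \<open>uv\<close> keeps the name \<open>u\<close>. Loops are dropped,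
  and parallel edges are merged since arcs form a set of pairs.
\<close>
definition contract_edge :: "'a pair_pre_digraph \<Rightarrow> 'a \<Rightarrow> 'a \<Rightarrow> 'a pair_pre_digraph" where
  "contract_edge G u v =
     (let f = id(v := u) in
      \<lparr> pverts = f ` pverts G,
        parcs = {(f x, f y) | x y. (x, y) \<in> parcs G \<and> f x \<noteq> f y} \<rparr>)"

inductive contracts_to :: "'a pair_pre_digraph \<Rightarrow> 'a pair_pre_digraph \<Rightarrow> bool" where
  refl: "contracts_to G G"
| step: "contracts_to G G' \<Longrightarrow> (u, v) \<in> parcs G' \<Longrightarrow> contracts_to G (contract_edge G' u v)"

definition is_minor :: "'b pair_pre_digraph \<Rightarrow> 'a pair_pre_digraph \<Rightarrow> bool" where
  "is_minor X G \<longleftrightarrow>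
     (\<exists>G' G''. pair_graph G' \<and> subgraph (with_proj G') (with_proj G) \<and>
               contracts_to G' G'' \<and> digraph_iso (with_proj X) (with_proj G''))"

abbreviation minor_free :: "'b pair_pre_digraph \<Rightarrow> 'a pair_pre_digraph \<Rightarrow> bool" where
  "minor_free X G \<equiv> \<not> is_minor X G"

subsection \<open>Particular graphs and the strong product\<close>

definition complete_graph :: "nat \<Rightarrow> nat pair_pre_digraph" where
  "complete_graph m =
     \<lparr> pverts = {..<m}, parcs = {(i, j). i < m \<and> j < m \<and> i \<noteq> j} \<rparr>"

definition path_graph :: "nat \<Rightarrow> nat pair_pre_digraph" where
  "path_graph n =
     \<lparr> pverts = {..<n}, parcs = {(i, j). i < n \<and> j < n \<and> (j = Suc i \<or> i = Suc j)} \<rparr>"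

text \<open>The graph $K^*_{s,t}$, with clique \<open>A\<close> and independent set \<open>B\<close>.\<close>
definition K_star :: "nat \<Rightarrow> nat \<Rightarrow> nat pair_pre_digraph" where
  "K_star s t =
     (let A = {..<s}; B = {s..<s + t} in
      \<lparr> pverts = A \<union> B,
        parcs = {(u, v). u \<in> A \<and> v \<in> A \<and> u \<noteq> v} \<union> A \<times> B \<union> B \<times> A \<rparr>)"

definition strong_product ::
    "'a pair_pre_digraph \<Rightarrow> 'b pair_pre_digraph \<Rightarrow> ('a \<times> 'b) pair_pre_digraph"
    (infixl \<open>\<boxtimes>\<close> 70) where
  "A \<boxtimes> B =
     \<lparr> pverts = pverts A \<times> pverts B,
       parcs = {((v, x), (w, y)). {v, w} \<subseteq> pverts A \<and> {x, y} \<subseteq> pverts B \<and> (v, x) \<noteq> (w, y) \<and>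
         (v = w \<and> (x, y) \<in> parcs B \<or>
          x = y \<and> (v, w) \<in> parcs A \<or>
          (v, w) \<in> parcs A \<and> (x, y) \<in> parcs B)} \<rparr>"

subsection \<open>Tree-decompositions, treewidth and layered treewidth\<close>

text \<open>
  The predicate \<^const>\<open>tree\<close> is unsuitable here: in a symmetric digraph each edge \<open>uv\<close> gives
  the directed cycle \<open>u, v, u\<close>. Cycles of an undirected graph have length at least 3.
\<close>
definition undirected_tree :: "'a pair_pre_digraph \<Rightarrow> bool" where
  "undirected_tree T \<longleftrightarrow>
     pair_graph T \<and> Digraph_Component.connected (with_proj T) \<and>
     \<not> (\<exists>p. pre_digraph.cycle (with_proj T) p \<and> length p \<ge> 3)"

text \<open>
  A graph that is \<^const>\<open>Digraph_Component.connected\<close> is non-empty, so that every vertex of \<open>G\<close>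
  lies in some bag.
\<close>
definition tree_decomposition ::
    "'a pair_pre_digraph \<Rightarrow> 'b pair_pre_digraph \<Rightarrow> ('b \<Rightarrow> 'a set) \<Rightarrow> bool" where
  "tree_decomposition G T W \<longleftrightarrow>
     undirected_tree T \<and>
     (\<forall>x \<in> pverts T. W x \<subseteq> pverts G) \<and>
     (\<forall>(v, w) \<in> parcs G. \<exists>x \<in> pverts T. v \<in> W x \<and> w \<in> W x) \<and>
     (\<forall>v \<in> pverts G.
        Digraph_Component.connected (with_proj T \<restriction> {x \<in> pverts T. v \<in> W x}))"

text \<open>
  The width is the maximum size of a bag minus 1, so the null graph has treewidth \<open>- 1\<close>. Every finite
  tree has an isomorphic copy with vertices in \<^typ>\<open>nat\<close>.
\<close>
definition treewidth :: "'a pair_pre_digraph \<Rightarrow> int" where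
  "treewidth G =
     int (LEAST k. \<exists>(T :: nat pair_pre_digraph) W.
            tree_decomposition G T W \<and> (\<forall>x \<in> pverts T. card (W x) \<le> k)) - 1"

text \<open>Layers may be empty.\<close>
definition layering :: "'a pair_pre_digraph \<Rightarrow> (nat \<Rightarrow> 'a set) \<Rightarrow> bool" where
  "layering G L \<longleftrightarrow>
     (\<Union>i. L i) = pverts G \<and> disjoint_family L \<and>
     (\<forall>i j v w. (v, w) \<in> parcs G \<and> v \<in> L i \<and> w \<in> L j \<longrightarrow> \<bar>int i - int j\<bar> \<le> 1)"

definition layered_treewidth :: "'a pair_pre_digraph \<Rightarrow> nat" where
  "layered_treewidth G =
     (LEAST k. \<exists>L (T :: nat pair_pre_digraph) W.
        layering G L \<and> tree_decomposition G T W \<and>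
        (\<forall>i. \<forall>x \<in> pverts T. card (L i \<inter> W x) \<le> k))"

end

theory Submission
  imports Defs
begin

text \<open>
  Fix a layering and a tree-decomposition attaining the layered treewidth. It suffices to partition
  \<open>V(G)\<close> into parts, each contained in the union of at most \<open>t - 1\<close> bags, such that the quotient graph
  has treewidth at most \<open>s\<close>: a part meets a layer in at most \<open>(t - 1) ltw(G)\<close> vertices, so the vertices
  of a part within a layer can be told apart by \<open>K\<^sub>m\<close>.

  The parts are built one at a time. Every component \<open>C\<close> of the uncovered vertices is attached to at
  most \<open>s\<close> earlier parts, which lie in pairwise adjacent disjoint connected branch sets outside \<open>C\<close>.
  Consider the connected subsets of \<open>C\<close> that touch all branch sets. If there are \<open>s\<close> branch sets, then
  \<open>t\<close> disjoint such subsets would give a \<open>K\<^sup>*\<^sub>s\<^sub>,\<^sub>t\<close> minor, so by the Erdos-Posa property of subtrees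
  \<open>t - 1\<close> bags meet all of them. If there are fewer, one bag, restricted to one such subset \<open>D\<close>,
  separates \<open>D\<close> from the others, and \<open>D\<close> serves as an additional branch set. An inclusion-minimal set
  of this kind is the next part; a remaining component that misses some branch set is handled by
  enlarging that branch set.
\<close>

section \<open>Connected sets and components\<close>

definition connected_on :: "'a rel \<Rightarrow> 'a set \<Rightarrow> bool" where
  "connected_on E S \<longleftrightarrow> (\<forall>u\<in>S. \<forall>v\<in>S. (u, v) \<in> rtrancl_on S E)"

definition touches :: "'a rel \<Rightarrow> 'a set \<Rightarrow> 'a set \<Rightarrow> bool" where
  "touches E A B \<longleftrightarrow> (\<exists>u\<in>A. \<exists>v\<in>B. (u, v) \<in> E)"

definition connected_subset :: "'a rel \<Rightarrow> 'a set \<Rightarrow> 'a set \<Rightarrow> bool" where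
  "connected_subset E S D \<longleftrightarrow> D \<subseteq> S \<and> D \<noteq> {} \<and> connected_on E D"

definition component :: "'a rel \<Rightarrow> 'a set \<Rightarrow> 'a set \<Rightarrow> bool" where
  "component E S C \<longleftrightarrow> connected_subset E S C \<and> (\<forall>u\<in>C. \<forall>v\<in>S - C. (u, v) \<notin> E)"

lemma touches_sym: "sym E \<Longrightarrow> touches E A B \<longleftrightarrow> touches E B A"
  by (auto simp: touches_def dest: symD)

lemma touches_mono: "touches E A B \<Longrightarrow> A \<subseteq> A' \<Longrightarrow> B \<subseteq> B' \<Longrightarrow> touches E A' B'"
  by (auto simp: touches_def)

lemma connected_on_singleton [simp]: "connected_on E {x}"
  by (simp add: connected_on_def)

lemma connected_onI_root:
  assumes "sym E" "\<And>v. v \<in> S \<Longrightarrow> (x, v) \<in> rtrancl_on S E"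
  shows "connected_on E S"
  unfolding connected_on_def
proof (intro ballI)
  fix u v assume "u \<in> S" "v \<in> S"
  then have "(u, x) \<in> rtrancl_on S E" "(x, v) \<in> rtrancl_on S E"
    using assms(2) symD[OF rtrancl_on_sym[OF assms(1)]] by blast+
  then show "(u, v) \<in> rtrancl_on S E" by (rule rtrancl_on_trans)
qed

lemma connected_on_rtrancl_on:
  "connected_on E D \<Longrightarrow> D \<subseteq> S \<Longrightarrow> u \<in> D \<Longrightarrow> v \<in> D \<Longrightarrow> (u, v) \<in> rtrancl_on S E"
  unfolding connected_on_def using rtrancl_on_mono[of E E D S] by blast

lemma connected_on_image:
  assumes "connected_on E S"
    and edge: "\<And>x y. x \<in> S \<Longrightarrow> y \<in> S \<Longrightarrow> (x, y) \<in> E \<Longrightarrow> g x \<noteq> g y \<Longrightarrow> (g x, g y) \<in> E'"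
  shows "connected_on E' (g ` S)"
proof -
  have "(g x, g y) \<in> rtrancl_on (g ` S) E'" if "(x, y) \<in> rtrancl_on S E" for x y
    using that
  proof (induction rule: rtrancl_on_induct)
    case (step y z)
    then show ?case
      using edge[of y z] by (cases "g y = g z") (auto intro: rtrancl_on_into_rtrancl_on)
  qed simp
  then show ?thesis using assms(1) by (simp add: connected_on_def)
qed

lemma connected_on_edges_mono:
  assumes "connected_on E S" "E \<inter> S \<times> S \<subseteq> E'"
  shows "connected_on E' S"
proof -
  have "connected_on E' (id ` S)" by (rule connected_on_image[OF assms(1)]) (use assms(2) in auto)
  then show ?thesis by simp
qed

lemma connected_on_subsetI:
  assumes "connected_on E D" "x \<in> D" "x \<in> P"
    and closed: "\<And>u v. u \<in> D \<Longrightarrow> u \<in> P \<Longrightarrow> v \<in> D \<Longrightarrow> (u, v) \<in> E \<Longrightarrow> v \<in> P"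
  shows "D \<subseteq> P"
proof
  fix y assume "y \<in> D"
  then have "(x, y) \<in> rtrancl_on D E" using assms(1,2) by (simp add: connected_on_def)
  then show "y \<in> P"
  proof (induction rule: rtrancl_on_induct)
    case (step y z)
    then show ?case using closed[of y z] by blast
  qed (use \<open>x \<in> P\<close> in simp)
qed

lemma connected_on_crossing:
  assumes "connected_on E S" "x \<in> S" "x \<in> P" "y \<in> S" "y \<notin> P"
  obtains u v where "u \<in> S \<inter> P" "v \<in> S - P" "(u, v) \<in> E"
proof (rule ccontr)
  assume "\<not> thesis"
  then have "S \<subseteq> P" by (intro connected_on_subsetI[OF assms(1-3)]) (use that in blast)
  then show False using assms(4,5) by blast
qed

lemma connected_on_induct [consumes 3, case_names singleton insert]:
  assumes "finite S" "connected_on E S" "x \<in> S"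
    and "P {x}"
    and step: "\<And>D u v. D \<subseteq> S \<Longrightarrow> P D \<Longrightarrow> u \<in> D \<Longrightarrow> v \<in> S - D \<Longrightarrow> (u, v) \<in> E \<Longrightarrow> P (insert v D)"
  shows "P S"
proof -
  define A where "A = {D \<in> Pow S. x \<in> D \<and> P D}"
  have "finite A" using assms(1) by (simp add: A_def)
  moreover have "{x} \<in> A" using assms(3,4) by (simp add: A_def)
  ultimately obtain D where "D \<in> A" and max: "\<forall>D'\<in>A. D \<subseteq> D' \<longrightarrow> D = D'"
    using finite_has_maximal2 by metis
  then have D: "D \<subseteq> S" "x \<in> D" "P D" by (simp_all add: A_def)
  have "D = S"
  proof (rule ccontr)
    assume "D \<noteq> S"
    then obtain y where "y \<in> S" "y \<notin> D" using D(1) by blast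
    then obtain u v where uv: "u \<in> S \<inter> D" "v \<in> S - D" "(u, v) \<in> E"
      by (rule connected_on_crossing[OF assms(2,3) D(2)])
    then have "P (insert v D)" by (intro step[OF D(1,3), of u]) simp_all
    then have "insert v D \<in> A" using D uv(2) by (simp add: A_def)
    then have "D = insert v D" using max by blast
    then show False using uv(2) by blast
  qed
  then show ?thesis using D(3) by simp
qed

lemma connected_on_Un:
  assumes "sym E" "connected_on E A" "connected_on E B" "A \<inter> B \<noteq> {} \<or> touches E A B"
  shows "connected_on E (A \<union> B)"
proof -
  let ?R = "rtrancl_on (A \<union> B) E"
  have A: "(u, v) \<in> ?R" if "u \<in> A" "v \<in> A" for u v
    by (rule connected_on_rtrancl_on[OF assms(2) _ that]) simp
  have B: "(u, v) \<in> ?R" if "u \<in> B" "v \<in> B" for u v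
    by (rule connected_on_rtrancl_on[OF assms(3) _ that]) simp
  have "\<exists>a\<in>A. \<exists>b\<in>B. (a, b) \<in> ?R"
    using assms(4)
  proof
    assume "A \<inter> B \<noteq> {}"
    then obtain c where "c \<in> A" "c \<in> B" by blast
    then show ?thesis using A[of c c] by blast
  next
    assume "touches E A B"
    then obtain a b where ab: "a \<in> A" "b \<in> B" "(a, b) \<in> E" unfolding touches_def by blast
    then have "(a, b) \<in> ?R" using rtrancl_on_into_rtrancl_on[of a a] by simp
    then show ?thesis using ab by blast
  qed
  then obtain a b where ab: "a \<in> A" "b \<in> B" "(a, b) \<in> ?R" by blast
  show ?thesis
  proof (rule connected_onI_root[OF assms(1)])
    fix v assume "v \<in> A \<union> B"
    then show "(a, v) \<in> ?R"
    proof
      assume "v \<in> A"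
      then show ?thesis by (rule A[OF ab(1)])
    next
      assume "v \<in> B"
      then show ?thesis by (rule rtrancl_on_trans[OF ab(3) B[OF ab(2)]])
    qed
  qed
qed

lemma connected_on_Un_attached:
  assumes "sym E" "connected_on E A" "A \<noteq> {}"
    and attached: "\<And>x. x \<in> S \<Longrightarrow> \<exists>D\<subseteq>S. x \<in> D \<and> connected_on E D \<and> touches E D A"
  shows "connected_on E (A \<union> S)"
proof -
  obtain a where a: "a \<in> A" using assms(3) by blast
  show ?thesis
  proof (rule connected_onI_root[OF assms(1)])
    fix x assume x: "x \<in> A \<union> S"
    have "\<exists>D\<subseteq>A \<union> S. connected_on E D \<and> a \<in> D \<and> x \<in> D"
    proof (cases "x \<in> A")
      case True
      then show ?thesis using assms(2) a by (intro exI[of _ A]) simp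
    next
      case False
      then obtain D where D: "D \<subseteq> S" "x \<in> D" "connected_on E D" "touches E D A"
        using attached[of x] x by auto
      then have "connected_on E (D \<union> A)" using connected_on_Un[OF assms(1) D(3) assms(2)] by simp
      then show ?thesis using D a by (intro exI[of _ "D \<union> A"]) auto
    qed
    then show "(a, x) \<in> rtrancl_on (A \<union> S) E" using connected_on_rtrancl_on by metis
  qed
qed

lemma componentI:
  assumes "C \<subseteq> S" "C \<noteq> {}" "connected_on E C"
    and "\<And>u v. u \<in> C \<Longrightarrow> (u, v) \<in> E \<Longrightarrow> v \<in> S \<Longrightarrow> v \<in> C"
  shows "component E S C"
  using assms by (auto simp: component_def connected_subset_def)

lemma componentD:
  assumes "component E S C"
  shows "C \<subseteq> S" "C \<noteq> {}" "connected_on E C" "u \<in> C \<Longrightarrow> (u, v) \<in> E \<Longrightarrow> v \<in> S \<Longrightarrow> v \<in> C"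
  using assms by (auto simp: component_def connected_subset_def)

lemma component_superset:
  assumes "sym E" "finite S" "connected_subset E S D"
  obtains C where "component E S C" "D \<subseteq> C"
proof -
  define A where "A = {C \<in> Pow S. D \<subseteq> C \<and> connected_subset E S C}"
  have "finite A" using assms(2) by (simp add: A_def)
  moreover have "D \<in> A" using assms(3) by (simp add: A_def connected_subset_def)
  ultimately obtain C where "C \<in> A" and max: "\<forall>C'\<in>A. C \<subseteq> C' \<longrightarrow> C = C'"
    using finite_has_maximal2 by metis
  then have C: "C \<subseteq> S" "D \<subseteq> C" "C \<noteq> {}" "connected_on E C"
    by (simp_all add: A_def connected_subset_def)
  have "component E S C"
  proof (rule componentI[OF C(1,3,4)])
    fix u v assume uv: "u \<in> C" "(u, v) \<in> E" "v \<in> S"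
    then have "connected_on E (C \<union> {v})"
      using connected_on_Un[OF assms(1) C(4), of "{v}"] by (auto simp: touches_def)
    then have "insert v C \<in> A" using C uv(3) by (auto simp: A_def connected_subset_def)
    then show "v \<in> C" using max by blast
  qed
  then show ?thesis using C(2) by (rule that)
qed

lemma component_containing:
  assumes "sym E" "finite S" "x \<in> S"
  obtains C where "component E S C" "x \<in> C"
proof -
  have "connected_subset E S {x}" using assms(3) by (simp add: connected_subset_def)
  then show ?thesis by (rule component_superset[OF assms(1,2)]) (use that in blast)
qed

lemma component_absorbs:
  assumes "component E S C" "connected_on E D" "D \<subseteq> S" "D \<inter> C \<noteq> {}"
  shows "D \<subseteq> C"
proof -
  obtain x where "x \<in> D" "x \<in> C" using assms(4) by blast
  then show ?thesis
  proof (rule connected_on_subsetI[OF assms(2)])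
    fix u v assume "u \<in> C" "v \<in> D" "(u, v) \<in> E"
    then show "v \<in> C" using componentD(4)[OF assms(1)] assms(3) by (meson subsetD)
  qed
qed

lemma component_eq_or_disjoint:
  assumes "component E S C" "component E S C'"
  shows "C = C' \<or> C \<inter> C' = {}"
  using component_absorbs[OF assms(1) componentD(3,1)[OF assms(2)]]
    component_absorbs[OF assms(2) componentD(3,1)[OF assms(1)]] by auto

lemma component_Diff_cases:
  assumes "sym E" "component E S C" "X \<subseteq> C" "component E (S - X) K"
  obtains "component E (C - X) K" | "component E S K" "K \<inter> C = {}"
proof -
  note C = componentD[OF assms(2)] and K = componentD[OF assms(4)]
  show ?thesis
  proof (cases "K \<inter> C = {}")
    case True
    have "component E S K"
    proof (rule componentI)
      fix u v assume uv: "u \<in> K" "(u, v) \<in> E" "v \<in> S"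
      have "v \<notin> X"
      proof
        assume "v \<in> X"
        then have "v \<in> C" using assms(3) by (rule subsetD[rotated])
        then have "u \<in> C" using C(4) symD[OF assms(1) uv(2)] K(1) uv(1) by blast
        then show False using True uv(1) by blast
      qed
      then show "v \<in> K" using K(4) uv by simp
    qed (use K(1-3) in auto)
    then show ?thesis using True by (rule that(2))
  next
    case False
    have "K \<subseteq> S" using K(1) by auto
    then have "K \<subseteq> C" by (rule component_absorbs[OF assms(2) K(3) _ False])
    have "component E (C - X) K"
    proof (rule componentI[OF _ K(2,3)])
      show "K \<subseteq> C - X" using \<open>K \<subseteq> C\<close> K(1) by auto
      show "v \<in> K" if "u \<in> K" "(u, v) \<in> E" "v \<in> C - X" for u v
        by (rule K(4)[OF that(1,2)]) (use that(3) C(1) in auto)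
    qed
    then show ?thesis by (rule that(1))
  qed
qed

section \<open>Rooted trees\<close>

text \<open>The nodes are numbered such that parents precede their children.\<close>
locale rooted_tree =
  fixes n :: nat and parent :: "nat \<Rightarrow> nat"
  assumes parent_less: "0 < i \<Longrightarrow> i < n \<Longrightarrow> parent i < i"
begin

inductive descendant :: "nat \<Rightarrow> nat \<Rightarrow> bool" for i where
  self: "descendant i i"
| step: "i < k \<Longrightarrow> descendant i (parent k) \<Longrightarrow> descendant i k"

definition subtree :: "nat set \<Rightarrow> bool" where
  "subtree A \<longleftrightarrow> A \<subseteq> {..<n} \<and> (\<forall>a\<in>A. \<forall>b\<in>A. b < a \<longrightarrow> parent a \<in> A)"

definition tree_graph :: "nat pair_pre_digraph" where
  "tree_graph = \<lparr> pverts = {..<n},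
     parcs = {(i, j). i < n \<and> j < n \<and> (0 < i \<and> j = parent i \<or> 0 < j \<and> i = parent j)} \<rparr>"

lemma descendant_ge: "descendant i k \<Longrightarrow> i \<le> k"
  by (induction rule: descendant.induct) auto

lemma descendant_trans: "descendant j k \<Longrightarrow> descendant i j \<Longrightarrow> descendant i k"
proof (induction rule: descendant.induct)
  case (step k)
  then show ?case using descendant_ge[of i j] by (simp add: descendant.step)
qed

lemma descendant_linear:
  assumes "descendant i k" "descendant j k" "i \<le> j"
  shows "descendant i j"
  using assms
proof (induction rule: descendant.induct)
  case self
  then show ?case using descendant_ge[of j i] by (simp add: descendant.self)
next
  case (step k)
  from \<open>descendant j k\<close> show ?case
  proof cases
    case self
    then show ?thesis using step.hyps by (simp add: descendant.step)
  next
    case step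
    then show ?thesis using step.IH \<open>i \<le> j\<close> by blast
  qed
qed

lemma subtree_finite: "subtree A \<Longrightarrow> finite A"
  unfolding subtree_def using finite_subset by blast

lemma subtree_Min: "subtree A \<Longrightarrow> a \<in> A \<Longrightarrow> Min A \<in> A \<and> Min A \<le> a"
  using subtree_finite Min_in[of A] Min_le[of A a] by blast

lemma subtree_induct [consumes 2, case_names root child]:
  assumes A: "subtree A" and "a \<in> A"
    and root: "P (Min A)"
    and child: "\<And>a. a \<in> A \<Longrightarrow> Min A < a \<Longrightarrow> parent a \<in> A \<Longrightarrow> P (parent a) \<Longrightarrow> P a"
  shows "P a"
  using \<open>a \<in> A\<close>
proof (induction a rule: less_induct)
  case (less a)
  show ?case
  proof (cases "a = Min A")
    case False
    then have lt: "Min A < a" and "Min A \<in> A" using subtree_Min[OF A less.prems] by auto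
    then have "parent a \<in> A" "a < n" using A less.prems unfolding subtree_def by auto
    moreover from this have "parent a < a" using parent_less[of a] lt by simp
    ultimately show ?thesis using child[OF less.prems lt] less.IH by simp
  qed (use root in simp)
qed

lemma subtree_Min_ancestor:
  assumes "subtree A" "a \<in> A"
  shows "descendant (Min A) a"
  using assms by (induction rule: subtree_induct) (auto intro: descendant.intros)

lemma subtree_contains_ancestor:
  assumes "subtree A" "descendant i k" "k \<in> A" "m \<in> A" "m \<le> i"
  shows "i \<in> A"
  using assms(2,3)
proof (induction rule: descendant.induct)
  case (step k)
  then have "parent k \<in> A" using assms(1,4,5) unfolding subtree_def by auto
  then show ?case by (rule step.IH)
qed

lemma subtree_descendants:
  assumes "subtree A" "descendant i k" "k \<in> A" "i \<le> Min A" "a \<in> A"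
  shows "descendant i a"
proof -
  have "descendant i (Min A)"
    using assms(2) subtree_Min_ancestor[OF assms(1,3)] assms(4) by (rule descendant_linear)
  then show ?thesis by (rule descendant_trans[OF subtree_Min_ancestor[OF assms(1,5)]])
qed

lemma subtree_contains_Min:
  assumes "subtree A" "subtree B" "A \<inter> B \<noteq> {}" "m \<in> B" "m \<le> Min A"
  shows "Min A \<in> B"
proof -
  obtain k where "k \<in> A" "k \<in> B" using assms(3) by blast
  then show ?thesis
    using subtree_contains_ancestor[OF assms(2) subtree_Min_ancestor[OF assms(1)]] assms(4,5) by blast
qed

lemma subtree_Un:
  assumes "subtree A" "subtree B" "A \<inter> B \<noteq> {}"
  shows "subtree (A \<union> B)"
proof -
  have parent: "parent a \<in> A \<union> B"
    if AB: "subtree A" "subtree B" "A \<inter> B \<noteq> {}" and ab: "a \<in> A" "b \<in> A \<union> B" "b < a" for A B a b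
  proof (cases "a = Min A")
    case True
    then have "b \<in> B" using ab subtree_Min[OF AB(1), of b] by auto
    moreover from this have "a \<in> B" using subtree_contains_Min[OF AB] ab True by simp
    ultimately show ?thesis using AB(2) ab(3) unfolding subtree_def by auto
  next
    case False
    then have "Min A \<in> A" "Min A < a" using subtree_Min[OF AB(1) ab(1)] by auto
    then show ?thesis using AB(1) ab(1) unfolding subtree_def by blast
  qed
  have "parent a \<in> A \<union> B" if "a \<in> A \<union> B" "b \<in> A \<union> B" "b < a" for a b
    using that(1)
  proof
    assume "a \<in> A"
    then show ?thesis using parent[OF assms] that(2,3) by simp
  next
    assume "a \<in> B"
    then show ?thesis
      using parent[OF assms(2,1)] assms(3) that(2,3) by (simp add: Un_commute Int_commute)
  qed
  then show ?thesis using assms(1,2) unfolding subtree_def by simp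
qed

lemma tree_graph_simps [simp]:
  "pverts tree_graph = {..<n}"
  "(i, j) \<in> parcs tree_graph \<longleftrightarrow>
     i < n \<and> j < n \<and> (0 < i \<and> j = parent i \<or> 0 < j \<and> i = parent j)"
  by (auto simp: tree_graph_def)

lemma sym_tree_graph: "sym (parcs tree_graph)"
  by (auto simp: sym_def)

lemma subtree_imp_connected_on:
  assumes "subtree A"
  shows "connected_on (parcs tree_graph) A"
proof (rule connected_onI_root[OF sym_tree_graph])
  fix a assume "a \<in> A"
  with assms show "(Min A, a) \<in> rtrancl_on A (parcs tree_graph)"
  proof (induction rule: subtree_induct)
    case root
    show ?case using subtree_Min[OF assms \<open>a \<in> A\<close>] by simp
  next
    case (child b)
    have "b < n" "parent b < n" using child.hyps assms by (auto simp: subtree_def)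
    then have "(parent b, b) \<in> parcs tree_graph" using child.hyps by simp
    then show ?case using child by (simp add: rtrancl_on_into_rtrancl_on)
  qed
qed

end

section \<open>Tree-decompositions over rooted trees\<close>

definition covered :: "('i \<Rightarrow> 'a set) \<Rightarrow> 'i set \<Rightarrow> nat \<Rightarrow> 'a set \<Rightarrow> bool" where
  "covered W I q X \<longleftrightarrow> (\<exists>Z\<subseteq>I. finite Z \<and> card Z \<le> q \<and> X \<subseteq> (\<Union>z\<in>Z. W z))"

lemma covered_empty: "covered W I q {}"
  unfolding covered_def by (rule exI[of _ "{}"]) simp

lemma covered_mono: "covered W I q X \<Longrightarrow> Y \<subseteq> X \<Longrightarrow> q \<le> r \<Longrightarrow> covered W I r Y"
  unfolding covered_def by (meson order.trans)

lemma covered_bag: "z \<in> I \<Longrightarrow> covered W I 1 (W z)"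
  unfolding covered_def by (rule exI[of _ "{z}"]) simp

lemma covered_Un:
  assumes "covered W I q X" "covered W I r Y"
  shows "covered W I (q + r) (X \<union> Y)"
proof -
  obtain Z Z' where Z: "Z \<subseteq> I" "finite Z" "card Z \<le> q" "X \<subseteq> (\<Union>z\<in>Z. W z)"
    and Z': "Z' \<subseteq> I" "finite Z'" "card Z' \<le> r" "Y \<subseteq> (\<Union>z\<in>Z'. W z)"
    using assms unfolding covered_def by blast
  have "card (Z \<union> Z') \<le> q + r" using card_Un_le[of Z Z'] Z(3) Z'(3) by linarith
  then show ?thesis unfolding covered_def using Z Z' by (intro exI[of _ "Z \<union> Z'"]) auto
qed

lemma covered_reindex:
  assumes "covered (W \<circ> g) I q X"
  shows "covered W (g ` I) q X"
proof -
  obtain Z where Z: "Z \<subseteq> I" "finite Z" "card Z \<le> q" "X \<subseteq> (\<Union>z\<in>Z. (W \<circ> g) z)"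
    using assms unfolding covered_def by blast
  have "card (g ` Z) \<le> q" using card_image_le[OF Z(2), of g] Z(3) by linarith
  then show ?thesis unfolding covered_def using Z by (intro exI[of _ "g ` Z"]) auto
qed

lemma card_Int_covered_le:
  assumes "covered W I q X" "finite L" "\<And>z. z \<in> I \<Longrightarrow> card (L \<inter> W z) \<le> w"
  shows "card (L \<inter> X) \<le> q * w"
proof -
  obtain Z where Z: "Z \<subseteq> I" "finite Z" "card Z \<le> q" "X \<subseteq> (\<Union>z\<in>Z. W z)"
    using assms(1) unfolding covered_def by blast
  have "card (L \<inter> X) \<le> card (\<Union>z\<in>Z. L \<inter> W z)"
    using Z(2,4) assms(2) by (intro card_mono) auto
  also have "\<dots> \<le> (\<Sum>z\<in>Z. card (L \<inter> W z))" by (rule card_UN_le[OF Z(2)])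
  also have "\<dots> \<le> card Z * w"
    using sum_bounded_above[of Z "\<lambda>z. card (L \<inter> W z)" w] Z(1) assms(3) by auto
  also have "\<dots> \<le> q * w" using Z(3) by simp
  finally show ?thesis .
qed

locale rooted_tree_decomposition = rooted_tree n parent
  for n :: nat and parent :: "nat \<Rightarrow> nat" +
  fixes V :: "'a set" and E :: "'a rel" and W :: "nat \<Rightarrow> 'a set"
  assumes finite_V: "finite V"
    and sym_E: "sym E"
    and E_subset: "E \<subseteq> V \<times> V"
    and edge_bag: "(u, v) \<in> E \<Longrightarrow> \<exists>i<n. u \<in> W i \<and> v \<in> W i"
    and vertex_bag: "v \<in> V \<Longrightarrow> \<exists>i<n. v \<in> W i"
    and vertex_subtree: "v \<in> V \<Longrightarrow> subtree {i. i < n \<and> v \<in> W i}"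
begin

definition nodes :: "'a set \<Rightarrow> nat set" where
  "nodes D = {i. i < n \<and> D \<inter> W i \<noteq> {}}"

definition root :: "'a set \<Rightarrow> nat" where
  "root D = Min (nodes D)"

lemma nodes_Un: "nodes (A \<union> B) = nodes A \<union> nodes B"
  by (auto simp: nodes_def)

lemma subtree_nodes_singleton: "v \<in> V \<Longrightarrow> subtree (nodes {v})"
  using vertex_subtree by (simp add: nodes_def)

lemma nodes_nonempty:
  assumes "D \<subseteq> V" "D \<noteq> {}"
  shows "nodes D \<noteq> {}"
proof -
  obtain v where "v \<in> D" "v \<in> V" using assms by blast
  moreover from this obtain i where "i < n" "v \<in> W i" using vertex_bag by blast
  ultimately show ?thesis by (auto simp: nodes_def)
qed

lemma subtree_nodes:
  assumes "connected_subset E V D"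
  shows "subtree (nodes D)"
proof -
  have D: "D \<subseteq> V" "connected_on E D" using assms by (auto simp: connected_subset_def)
  obtain x where x: "x \<in> D" using assms by (auto simp: connected_subset_def)
  have "finite D" using D(1) finite_V by (rule finite_subset)
  then show ?thesis using D(2) x
  proof (rule connected_on_induct)
    show "subtree (nodes {x})" using subtree_nodes_singleton D(1) x by blast
  next
    fix D' u v assume IH: "subtree (nodes D')" and uv: "u \<in> D'" "v \<in> D - D'" "(u, v) \<in> E"
    have "v \<in> V" using D(1) uv(2) by blast
    moreover have "nodes {v} \<inter> nodes D' \<noteq> {}"
      using edge_bag[OF uv(3)] uv(1) by (auto simp: nodes_def)
    ultimately have "subtree (nodes {v} \<union> nodes D')"
      by (rule subtree_Un[OF subtree_nodes_singleton IH])
    then show "subtree (nodes (insert v D'))" using nodes_Un[of "{v}" D'] by simp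
  qed
qed

lemma root_in_nodes:
  assumes "connected_subset E V D"
  shows "root D \<in> nodes D"
  unfolding root_def using assms subtree_finite[OF subtree_nodes[OF assms]] nodes_nonempty[of D]
  by (intro Min_in) (auto simp: connected_subset_def)

lemma root_less: "connected_subset E V D \<Longrightarrow> root D < n"
  using root_in_nodes by (auto simp: nodes_def)

lemma descendant_root:
  assumes "connected_subset E V D" "v \<in> D" "k < n" "v \<in> W k"
  shows "descendant (root D) k"
  unfolding root_def
  by (rule subtree_Min_ancestor[OF subtree_nodes[OF assms(1)]])
    (use assms(2-4) in \<open>auto simp: nodes_def\<close>)

lemma descendant_through_missing_bag:
  assumes "v \<in> V" "v \<notin> W z" "j < n" "v \<in> W j" "descendant z j" "k < n" "v \<in> W k"
  shows "descendant z k"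
proof -
  let ?A = "{i. i < n \<and> v \<in> W i}"
  have A: "subtree ?A" by (rule vertex_subtree[OF assms(1)])
  have "Min ?A \<in> ?A" using subtree_Min[OF A] assms(3,4) by blast
  then have "z \<le> Min ?A"
    using subtree_contains_ancestor[OF A assms(5), of "Min ?A"] assms(2-4) by force
  then show ?thesis using subtree_descendants[OF A assms(5)] assms(3,4,6,7) by simp
qed

lemma deepest_root:
  assumes "\<F> \<noteq> {}" "\<And>D. D \<in> \<F> \<Longrightarrow> connected_subset E V D"
  obtains D where "D \<in> \<F>" "\<forall>D'\<in>\<F>. root D' \<le> root D"
proof -
  obtain D\<^sub>0 where "D\<^sub>0 \<in> \<F>" using assms(1) by blast
  then have "\<exists>D. D \<in> \<F> \<and> (\<forall>D'. D' \<in> \<F> \<longrightarrow> root D' \<le> root D)"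
    by (rule ex_has_greatest_nat[where b = n]) (use root_less assms(2) in \<open>simp add: less_imp_le\<close>)
  then show ?thesis using that by blast
qed

lemma root_bag_meets:
  assumes D: "connected_subset E V D" and D': "connected_subset E V D'"
    and "D \<inter> D' \<noteq> {}" "root D' \<le> root D"
  shows "D' \<inter> W (root D) \<noteq> {}"
proof -
  obtain v where v: "v \<in> D" "v \<in> D'" using assms(3) by blast
  then have "v \<in> V" using D by (auto simp: connected_subset_def)
  then obtain i where "i < n" "v \<in> W i" using vertex_bag by blast
  then have "nodes D \<inter> nodes D' \<noteq> {}" using v by (auto simp: nodes_def)
  then have "root D \<in> nodes D'"
    using subtree_contains_Min[OF subtree_nodes[OF D] subtree_nodes[OF D'] _ root_in_nodes[OF D']]
      assms(4) by (simp add: root_def)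
  then show ?thesis by (simp add: nodes_def)
qed

lemma bag_meeting_intersecting_members:
  assumes "\<F> \<noteq> {}" and \<F>: "\<And>D. D \<in> \<F> \<Longrightarrow> connected_subset E V D"
  obtains D z where "D \<in> \<F>" "z < n" "\<forall>D'\<in>\<F>. D' \<inter> W z = {} \<longrightarrow> disjnt D D'"
proof -
  obtain D where D: "D \<in> \<F>" and deep: "\<forall>D'\<in>\<F>. root D' \<le> root D"
    by (rule deepest_root[OF assms])
  have "disjnt D D'" if "D' \<in> \<F>" "D' \<inter> W (root D) = {}" for D'
    using root_bag_meets[OF \<F>[OF D] \<F>[OF that(1)]] deep that by (auto simp: disjnt_def)
  then show ?thesis using that[OF D root_less[OF \<F>[OF D]]] by blast
qed

definition packing_or_hitting_bags :: "nat \<Rightarrow> 'a set set \<Rightarrow> bool" where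
  "packing_or_hitting_bags q \<F> \<longleftrightarrow>
     (\<exists>\<D>\<subseteq>\<F>. card \<D> = Suc q \<and> disjoint \<D>) \<or>
     (\<exists>X. covered W {..<n} q X \<and> (\<forall>D\<in>\<F>. D \<inter> X \<noteq> {}))"

lemma packing_or_hitting_bags_empty: "packing_or_hitting_bags q {}"
  unfolding packing_or_hitting_bags_def using covered_empty by blast

lemma packing_or_hitting_bags_step:
  assumes "D \<in> \<F>" "D \<noteq> {}" "z < n" and disj: "\<forall>D'\<in>\<F>. D' \<inter> W z = {} \<longrightarrow> disjnt D D'"
    and rest: "packing_or_hitting_bags q {D' \<in> \<F>. D' \<inter> W z = {}}"
  shows "packing_or_hitting_bags (Suc q) \<F>"
  using rest unfolding packing_or_hitting_bags_def
proof (elim disjE exE conjE)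
  fix \<D> assume \<D>: "\<D> \<subseteq> {D' \<in> \<F>. D' \<inter> W z = {}}" "card \<D> = Suc q" "disjoint \<D>"
  have disj_\<D>: "disjnt D D'" if "D' \<in> \<D>" for D'
    using disj subsetD[OF \<D>(1) that] by simp
  have "D \<notin> \<D>" using disj_\<D>[of D] assms(2) by (auto simp: disjnt_def)
  moreover have "finite \<D>" using \<D>(2) card.infinite by force
  moreover have "disjoint (insert D \<D>)"
    using \<D>(3) disj_\<D> by (auto simp: pairwise_insert disjnt_sym)
  moreover have "insert D \<D> \<subseteq> \<F>" using assms(1) \<D>(1) by auto
  ultimately show "(\<exists>\<D>\<subseteq>\<F>. card \<D> = Suc (Suc q) \<and> disjoint \<D>) \<or>
      (\<exists>X. covered W {..<n} (Suc q) X \<and> (\<forall>D\<in>\<F>. D \<inter> X \<noteq> {}))"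
    using \<D>(2) by (intro disjI1 exI[of _ "insert D \<D>"]) simp
next
  fix X assume X: "covered W {..<n} q X" "\<forall>D\<in>{D' \<in> \<F>. D' \<inter> W z = {}}. D \<inter> X \<noteq> {}"
  have "covered W {..<n} (q + 1) (X \<union> W z)"
    using assms(3) by (intro covered_Un X(1) covered_bag) simp
  moreover have "\<forall>D\<in>\<F>. D \<inter> (X \<union> W z) \<noteq> {}" using X(2) by auto
  ultimately show "(\<exists>\<D>\<subseteq>\<F>. card \<D> = Suc (Suc q) \<and> disjoint \<D>) \<or>
      (\<exists>X. covered W {..<n} (Suc q) X \<and> (\<forall>D\<in>\<F>. D \<inter> X \<noteq> {}))"
    by (intro disjI2 exI[of _ "X \<union> W z"]) simp
qed

text \<open>The Erdos-Posa property: subtrees of a tree are packed greedily, deepest root first.\<close>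
lemma packing_or_hitting_bags_connected_subsets:
  assumes "\<And>D. D \<in> \<F> \<Longrightarrow> connected_subset E V D"
  shows "packing_or_hitting_bags q \<F>"
  using assms
proof (induction q arbitrary: \<F>)
  case 0
  show ?case
  proof (cases "\<F> = {}")
    case False
    then obtain D where "D \<in> \<F>" by blast
    then have "{D} \<subseteq> \<F>" "card {D} = Suc 0" "disjoint {D}" by simp_all
    then show ?thesis unfolding packing_or_hitting_bags_def by blast
  qed (simp add: packing_or_hitting_bags_empty)
next
  case (Suc q)
  show ?case
  proof (cases "\<F> = {}")
    case False
    obtain D z where D: "D \<in> \<F>" "z < n" "\<forall>D'\<in>\<F>. D' \<inter> W z = {} \<longrightarrow> disjnt D D'"
      by (rule bag_meeting_intersecting_members[OF False Suc.prems])
    have "D \<noteq> {}" using Suc.prems[OF D(1)] by (simp add: connected_subset_def)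
    moreover have "packing_or_hitting_bags q {D' \<in> \<F>. D' \<inter> W z = {}}"
      by (rule Suc.IH) (simp add: Suc.prems)
    ultimately show ?thesis by (rule packing_or_hitting_bags_step[OF D(1) _ D(2,3)])
  qed (simp add: packing_or_hitting_bags_empty)
qed

definition below :: "nat \<Rightarrow> 'a set" where
  "below z = {v. \<exists>k<n. v \<in> W k \<and> descendant z k}"

lemma connected_subset_below_root:
  assumes "connected_subset E V D"
  shows "D \<subseteq> below (root D)"
proof
  fix v assume v: "v \<in> D"
  then have "v \<in> V" using assms by (auto simp: connected_subset_def)
  then obtain k where "k < n" "v \<in> W k" using vertex_bag by blast
  then show "v \<in> below (root D)" using descendant_root[OF assms v] by (auto simp: below_def)
qed

lemma component_below_absorbs:
  assumes "C \<subseteq> V" and D: "component E (C \<inter> below z) D"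
    and C': "C' \<subseteq> C" "connected_on E C'" "D \<inter> C' \<noteq> {}" "D \<inter> C' \<inter> W z = {}"
  shows "C' \<subseteq> D"
proof -
  obtain x where x: "x \<in> C'" "x \<in> D" using C'(3) by blast
  show ?thesis
  proof (rule connected_on_subsetI[OF C'(2) x])
    fix u v assume uv: "u \<in> C'" "u \<in> D" "v \<in> C'" "(u, v) \<in> E"
    obtain k where k: "k < n" "u \<in> W k" "v \<in> W k" using edge_bag[OF uv(4)] by blast
    have "u \<in> below z" using componentD(1)[OF D] uv(2) by blast
    then obtain j where j: "j < n" "u \<in> W j" "descendant z j" by (auto simp: below_def)
    have "u \<in> V" "u \<notin> W z" using uv(1,2) assms(1) C'(1,4) by auto
    then have "descendant z k" using descendant_through_missing_bag j k(1,2) by blast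
    then have "v \<in> C \<inter> below z" using k(1,3) uv(3) C'(1) by (auto simp: below_def)
    then show "v \<in> D" by (rule componentD(4)[OF D uv(2,4)])
  qed
qed

lemma deeper_than_missing_bag:
  assumes "v \<in> V" "v \<in> below z" "v \<notin> W z" "i < n" "v \<in> W i"
  shows "z < i"
proof -
  obtain j where "j < n" "v \<in> W j" "descendant z j" using assms(2) by (auto simp: below_def)
  then have "descendant z i" using descendant_through_missing_bag assms(1,3-5) by blast
  then have "z \<le> i" by (rule descendant_ge)
  then show ?thesis using assms(3,5) by (cases "i = z") auto
qed

text \<open>\<open>D\<close> contains a member of \<open>\<F>\<close> with deepest root.\<close>
lemma separating_bag:
  assumes "C \<subseteq> V" "\<F> \<noteq> {}" and \<F>: "\<And>D. D \<in> \<F> \<Longrightarrow> connected_subset E C D"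
    and up: "\<And>D D'. D \<in> \<F> \<Longrightarrow> D \<subseteq> D' \<Longrightarrow> connected_subset E C D' \<Longrightarrow> D' \<in> \<F>"
  obtains D z where "D \<in> \<F>" "z < n"
    "\<forall>C'. component E (C - D \<inter> W z) C' \<longrightarrow> C' \<in> \<F> \<longrightarrow> D \<inter> C' = {}"
proof -
  have \<F>_V: "connected_subset E V D" if "D \<in> \<F>" for D
    using \<F>[OF that] assms(1) by (auto simp: connected_subset_def)
  obtain D\<^sub>0 where D\<^sub>0: "D\<^sub>0 \<in> \<F>" and deep: "\<forall>D'\<in>\<F>. root D' \<le> root D\<^sub>0"
    by (rule deepest_root[OF assms(2) \<F>_V])
  define z where "z = root D\<^sub>0"
  have "z < n" unfolding z_def by (rule root_less[OF \<F>_V[OF D\<^sub>0]])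
  have "connected_subset E (C \<inter> below z) D\<^sub>0"
    using \<F>[OF D\<^sub>0] connected_subset_below_root[OF \<F>_V[OF D\<^sub>0]]
    by (simp add: connected_subset_def z_def)
  moreover have "finite (C \<inter> below z)" using finite_subset[OF assms(1) finite_V] by simp
  ultimately obtain D where D: "component E (C \<inter> below z) D" "D\<^sub>0 \<subseteq> D"
    using component_superset[OF sym_E] by metis
  have "connected_subset E C D" using componentD(1-3)[OF D(1)] by (simp add: connected_subset_def)
  then have "D \<in> \<F>" by (rule up[OF D\<^sub>0 D(2)])
  moreover have "D \<inter> C' = {}" if C': "component E (C - D \<inter> W z) C'" "C' \<in> \<F>" for C'
  proof (rule ccontr)
    assume meets: "D \<inter> C' \<noteq> {}"
    have "C' \<subseteq> C" "D \<inter> C' \<inter> W z = {}" using componentD(1)[OF C'(1)] by auto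
    then have "C' \<subseteq> D"
      using component_below_absorbs[OF assms(1) D(1) _ componentD(3)[OF C'(1)] meets] by blast
    obtain v where v: "v \<in> C'" "root C' < n" "v \<in> W (root C')"
      using root_in_nodes[OF \<F>_V[OF C'(2)]] by (auto simp: nodes_def)
    then have "v \<in> V" "v \<in> below z" "v \<notin> W z"
      using \<open>C' \<subseteq> D\<close> \<open>D \<inter> C' \<inter> W z = {}\<close> componentD(1)[OF D(1)] assms(1) by auto
    then have "z < root C'" using v(2,3) by (rule deeper_than_missing_bag)
    then show False using bspec[OF deep C'(2)] by (simp add: z_def)
  qed
  ultimately show ?thesis using that \<open>z < n\<close> by blast
qed

end

section \<open>Graphs and isomorphisms\<close>

lemma pair_graphI:
  assumes "finite (pverts G)" "parcs G \<subseteq> pverts G \<times> pverts G" "sym (parcs G)" "irrefl (parcs G)"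
  shows "pair_graph G"
proof
  show "finite (parcs G)" using assms(1,2) by (meson finite_SigmaI finite_subset)
  show "symmetric (with_proj G)" using assms(3) by (simp add: symmetric_def)
qed (use assms in \<open>auto simp: irrefl_def\<close>)

lemma pair_graphD:
  assumes "pair_graph G"
  shows "finite (pverts G)" "parcs G \<subseteq> pverts G \<times> pverts G" "sym (parcs G)" "irrefl (parcs G)"
proof -
  interpret pair_graph G by fact
  show "finite (pverts G)" by simp
  show "parcs G \<subseteq> pverts G \<times> pverts G" using in_arcsD1 in_arcsD2 by auto
  show "sym (parcs G)" using arcs_symmetric by (auto intro: symI)
  show "irrefl (parcs G)" using no_loops' by (auto simp: irrefl_def)
qed

lemma digraph_isoI:
  assumes "pair_graph G" "inj_on g (pverts G)" "pverts G' = g ` pverts G"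
    and "parcs G' = map_prod g g ` parcs G"
  shows "digraph_iso (with_proj G) (with_proj G')"
proof -
  interpret pair_graph G by fact
  let ?f = "\<lparr> iso_verts = g, iso_arcs = map_prod g g, iso_head = snd, iso_tail = fst \<rparr>"
  have "inj_on (map_prod g g) (parcs G)"
    using map_prod_inj_on[OF assms(2,2)] pair_graphD(2)[OF assms(1)] inj_on_subset by blast
  then have "pre_digraph.digraph_isomorphism (with_proj G) ?f"
    using assms(2) wf_digraph_axioms unfolding pre_digraph.digraph_isomorphism_def by auto
  moreover have "with_proj G' = app_iso ?f (with_proj G)"
    using assms by (simp add: app_iso_def with_proj_def)
  ultimately show ?thesis unfolding digraph_iso_def by blast
qed

lemma subgraph_with_projI:
  assumes "pair_graph G" "pair_graph K" "pverts K \<subseteq> pverts G" "parcs K \<subseteq> parcs G"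
  shows "subgraph (with_proj K) (with_proj G)"
proof -
  interpret G: pair_graph G by fact
  interpret K: pair_graph K by fact
  show ?thesis using assms G.wf_digraph_axioms K.wf_digraph_axioms by (intro subgraphI) auto
qed

lemma iso_to_subgraphI:
  assumes "pair_graph G" "pair_graph X" "inj_on g (pverts G)" "g ` pverts G \<subseteq> pverts X"
    and "\<And>u v. (u, v) \<in> parcs G \<Longrightarrow> (g u, g v) \<in> parcs X"
  shows "iso_to_subgraph G X"
proof -
  note G = pair_graphD[OF assms(1)]
  define K where "K = \<lparr> pverts = g ` pverts G, parcs = map_prod g g ` parcs G \<rparr>"
  have K: "pair_graph K"
  proof (rule pair_graphI)
    show "irrefl (parcs K)" using G(2,4) assms(3) by (auto simp: K_def irrefl_def inj_on_def)
    show "sym (parcs K)" using G(3) by (force simp: K_def sym_def)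
  qed (use G in \<open>auto simp: K_def\<close>)
  have "subgraph (with_proj K) (with_proj X)"
    by (rule subgraph_with_projI[OF assms(2) K]) (use assms(4,5) in \<open>auto simp: K_def\<close>)
  moreover have "digraph_iso (with_proj G) (with_proj K)"
    by (rule digraph_isoI[OF assms(1,3)]) (simp_all add: K_def)
  ultimately show ?thesis unfolding iso_to_subgraph_def using K by blast
qed

section \<open>Minor models\<close>

definition contraction_map :: "('a \<Rightarrow> 'b) \<Rightarrow> 'a pair_pre_digraph \<Rightarrow> 'b pair_pre_digraph \<Rightarrow> bool" where
  "contraction_map \<phi> K X \<longleftrightarrow>
     pverts X = \<phi> ` pverts K \<and> parcs X = map_prod \<phi> \<phi> ` parcs K - Id \<and>
     (\<forall>i\<in>pverts X. connected_on (parcs K) {v \<in> pverts K. \<phi> v = i})"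

lemma contract_edge_conv:
  "contract_edge G u v =
     \<lparr> pverts = id(v := u) ` pverts G, parcs = map_prod (id(v := u)) (id(v := u)) ` parcs G - Id \<rparr>"
proof -
  have "{(h x, h y) | x y. (x, y) \<in> parcs G \<and> h x \<noteq> h y} = map_prod h h ` parcs G - Id"
    for h :: "'a \<Rightarrow> 'a"
    by force
  then show ?thesis by (simp add: contract_edge_def Let_def)
qed

lemma pair_graph_contract_edge:
  assumes "pair_graph G"
  shows "pair_graph (contract_edge G u v)"
proof -
  note G = pair_graphD[OF assms]
  define h where "h = id(v := u)"
  have "pair_graph \<lparr> pverts = h ` pverts G, parcs = map_prod h h ` parcs G - Id \<rparr>"
  proof (rule pair_graphI)
    show "sym (parcs \<lparr> pverts = h ` pverts G, parcs = map_prod h h ` parcs G - Id \<rparr>)"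
      using G(3) by (force simp: sym_def)
  qed (use G(1,2) in \<open>auto simp: irrefl_def\<close>)
  then show ?thesis by (simp add: contract_edge_conv h_def)
qed

lemma card_contract_edge_less:
  assumes "pair_graph G" "(u, v) \<in> parcs G"
  shows "card (pverts (contract_edge G u v)) < card (pverts G)"
proof -
  note G = pair_graphD[OF assms(1)]
  have "u \<noteq> v" "v \<in> pverts G" using G(2,4) assms(2) by (auto simp: irrefl_def)
  then have "id(v := u) ` pverts G \<subset> pverts G" using G(2) assms(2) by auto
  then show ?thesis unfolding contract_edge_conv using G(1) by (simp add: psubset_card_mono)
qed

lemma contracts_to_contract_edge:
  assumes "contracts_to (contract_edge G u v) K" "(u, v) \<in> parcs G"
  shows "contracts_to G K"
  using assms
proof (induction "contract_edge G u v" K rule: contracts_to.induct)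
  case refl
  then show ?case by (intro contracts_to.step contracts_to.refl)
next
  case (step G' u v)
  then show ?case by (intro contracts_to.step) auto
qed

lemma contraction_map_contract_edge:
  assumes \<phi>: "contraction_map \<phi> K X" and "\<phi> u = \<phi> v"
  shows "contraction_map \<phi> (contract_edge K u v) X"
proof -
  define h where "h = id(v := u)"
  let ?K = "\<lparr> pverts = h ` pverts K, parcs = map_prod h h ` parcs K - Id \<rparr>"
  have \<phi>h: "\<phi> (h x) = \<phi> x" for x using assms(2) by (simp add: h_def)
  have "pverts X = \<phi> ` pverts ?K" using \<phi> by (simp add: contraction_map_def image_image \<phi>h)
  moreover have "parcs X = map_prod \<phi> \<phi> ` parcs ?K - Id"
  proof (intro equalityI subrelI)
    fix i j assume "(i, j) \<in> parcs X"
    then obtain x y where xy: "(x, y) \<in> parcs K" "i = \<phi> x" "j = \<phi> y" "i \<noteq> j"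
      using \<phi> by (auto simp: contraction_map_def)
    then have "h x \<noteq> h y" using \<phi>h by metis
    then have "(h x, h y) \<in> parcs ?K" using xy(1) by auto
    moreover have "(i, j) = map_prod \<phi> \<phi> (h x, h y)" using xy by (simp add: \<phi>h)
    ultimately show "(i, j) \<in> map_prod \<phi> \<phi> ` parcs ?K - Id" using xy(4) by blast
  next
    fix i j assume "(i, j) \<in> map_prod \<phi> \<phi> ` parcs ?K - Id"
    then obtain a b where ab: "(a, b) \<in> parcs ?K" "i = \<phi> a" "j = \<phi> b" "i \<noteq> j" by auto
    then obtain x y where "(x, y) \<in> parcs K" "a = h x" "b = h y" by auto
    then show "(i, j) \<in> parcs X" using \<phi> ab(2-4) by (auto simp: contraction_map_def \<phi>h)
  qed
  moreover have "connected_on (parcs ?K) {w \<in> pverts ?K. \<phi> w = i}" if "i \<in> pverts X" for i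
  proof -
    have "connected_on (parcs ?K) (h ` {w \<in> pverts K. \<phi> w = i})"
      by (rule connected_on_image[of "parcs K"])
        (use \<phi> that in \<open>auto simp: contraction_map_def intro: rev_image_eqI\<close>)
    moreover have "h ` {w \<in> pverts K. \<phi> w = i} = {w \<in> pverts ?K. \<phi> w = i}"
      by (auto simp: \<phi>h)
    ultimately show ?thesis by simp
  qed
  ultimately show ?thesis unfolding contract_edge_conv contraction_map_def h_def by simp
qed

lemma inj_contraction_map_imp_digraph_iso:
  assumes "pair_graph K" "contraction_map \<phi> K X" "inj_on \<phi> (pverts K)"
  shows "digraph_iso (with_proj X) (with_proj K)"
proof -
  interpret pair_graph K by fact
  have "\<phi> x \<noteq> \<phi> y" if "(x, y) \<in> parcs K" for x y
    using assms(3) in_arcsD1[OF that] in_arcsD2[OF that] no_loops'[OF that] by (auto dest: inj_onD)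
  then have "parcs X = map_prod \<phi> \<phi> ` parcs K"
    using assms(2) by (auto simp: contraction_map_def)
  then have "digraph_iso (with_proj K) (with_proj X)"
    using assms(2) by (intro digraph_isoI[OF assms(1,3)]) (simp_all add: contraction_map_def)
  then show ?thesis by (rule digraph_iso_swap[OF wf_digraph_axioms])
qed

lemma contraction_map_imp_contracts_to:
  assumes "pair_graph K" "contraction_map \<phi> K X"
  shows "\<exists>K'. contracts_to K K' \<and> digraph_iso (with_proj X) (with_proj K')"
  using assms
proof (induction "card (pverts K)" arbitrary: K rule: less_induct)
  case less
  show ?case
  proof (cases "inj_on \<phi> (pverts K)")
    case True
    then have "digraph_iso (with_proj X) (with_proj K)"
      by (rule inj_contraction_map_imp_digraph_iso[OF less.prems])
    then show ?thesis using contracts_to.refl by blast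
  next
    case False
    then obtain x y where xy: "x \<in> pverts K" "y \<in> pverts K" "x \<noteq> y" "\<phi> x = \<phi> y"
      by (auto simp: inj_on_def)
    let ?F = "{v \<in> pverts K. \<phi> v = \<phi> x}"
    have F: "connected_on (parcs K) ?F" "x \<in> ?F" "y \<in> ?F"
      using less.prems(2) xy by (auto simp: contraction_map_def)
    have "y \<notin> {x}" using xy(3) by simp
    then obtain u v where uv: "u \<in> ?F \<inter> {x}" "v \<in> ?F - {x}" "(u, v) \<in> parcs K"
      by (rule connected_on_crossing[OF F(1,2) singletonI F(3)])
    have "\<phi> u = \<phi> v" using uv(1,2) by simp
    then have "\<exists>K'. contracts_to (contract_edge K u v) K' \<and> digraph_iso (with_proj X) (with_proj K')"
      using less.hyps[OF card_contract_edge_less[OF less.prems(1) uv(3)]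
          pair_graph_contract_edge[OF less.prems(1)]
          contraction_map_contract_edge[OF less.prems(2)]] by simp
    then show ?thesis using contracts_to_contract_edge[OF _ uv(3)] by blast
  qed
qed

definition minor_model :: "'b pair_pre_digraph \<Rightarrow> 'a set \<Rightarrow> 'a rel \<Rightarrow> ('b \<Rightarrow> 'a set) \<Rightarrow> bool" where
  "minor_model X V E M \<longleftrightarrow>
     (\<forall>i\<in>pverts X. connected_subset E V (M i)) \<and> disjoint_family_on M (pverts X) \<and>
     (\<forall>(i, j)\<in>parcs X. touches E (M i) (M j))"

definition model_graph :: "'b pair_pre_digraph \<Rightarrow> 'a rel \<Rightarrow> ('b \<Rightarrow> 'a set) \<Rightarrow> 'a pair_pre_digraph" where
  "model_graph X E M = \<lparr> pverts = (\<Union>i\<in>pverts X. M i),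
     parcs = {(x, y) \<in> E. \<exists>i\<in>pverts X. \<exists>j\<in>pverts X. x \<in> M i \<and> y \<in> M j \<and> (i = j \<or> (i, j) \<in> parcs X)} \<rparr>"

definition model_index :: "'b pair_pre_digraph \<Rightarrow> ('b \<Rightarrow> 'a set) \<Rightarrow> 'a \<Rightarrow> 'b" where
  "model_index X M x = (THE i. i \<in> pverts X \<and> x \<in> M i)"

lemma pair_graph_model_graph:
  assumes "pair_graph G" "pair_graph X" "minor_model X (pverts G) (parcs G) M"
  shows "pair_graph (model_graph X (parcs G) M)" (is "pair_graph ?K")
proof (rule pair_graphI)
  note G = pair_graphD[OF assms(1)] and X = pair_graphD[OF assms(2)]
  have "pverts ?K \<subseteq> pverts G"
    using assms(3) by (auto simp: model_graph_def minor_model_def connected_subset_def)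
  then show "finite (pverts ?K)" using G(1) by (rule finite_subset)
  show "sym (parcs ?K)"
    by (rule symI) (auto simp: model_graph_def dest: symD[OF G(3)] symD[OF X(3)])
  show "irrefl (parcs ?K)" using G(4) by (auto simp: model_graph_def irrefl_def)
qed (auto simp: model_graph_def)

lemma model_index_eq:
  assumes "minor_model X V E M" "i \<in> pverts X" "x \<in> M i"
  shows "model_index X M x = i"
  unfolding model_index_def
  using assms by (intro the_equality) (auto simp: minor_model_def disjoint_family_on_def)

lemma contraction_map_model_index:
  assumes "pair_graph X" "minor_model X V E M"
  shows "contraction_map (model_index X M) (model_graph X E M) X" (is "contraction_map ?\<phi> ?K X")
proof -
  note X = pair_graphD[OF assms(1)] and index = model_index_eq[OF assms(2)]
  have M: "M i \<noteq> {}" "connected_on E (M i)" if "i \<in> pverts X" for i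
    using assms(2) that by (auto simp: minor_model_def connected_subset_def)
  have fibre: "{v \<in> pverts ?K. ?\<phi> v = i} = M i" if "i \<in> pverts X" for i
    using that index by (auto simp: model_graph_def)
  have "i \<in> ?\<phi> ` pverts ?K" if i: "i \<in> pverts X" for i
  proof -
    obtain x where "x \<in> {v \<in> pverts ?K. ?\<phi> v = i}"
      using M(1)[OF i] unfolding fibre[OF i] by blast
    then show ?thesis by blast
  qed
  moreover have "?\<phi> ` pverts ?K \<subseteq> pverts X" using index by (auto simp: model_graph_def)
  ultimately have "pverts X = ?\<phi> ` pverts ?K" by blast
  moreover have "parcs X = map_prod ?\<phi> ?\<phi> ` parcs ?K - Id"
  proof (intro equalityI subrelI)
    fix i j assume ij: "(i, j) \<in> parcs X"
    then have V: "i \<in> pverts X" "j \<in> pverts X" "i \<noteq> j" using X(2,4) by (auto simp: irrefl_def)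
    obtain x y where xy: "x \<in> M i" "y \<in> M j" "(x, y) \<in> E"
      using assms(2) ij by (auto simp: minor_model_def touches_def)
    then have "(x, y) \<in> parcs ?K" using ij V by (auto simp: model_graph_def)
    moreover have "(i, j) = map_prod ?\<phi> ?\<phi> (x, y)" using index V xy by simp
    ultimately show "(i, j) \<in> map_prod ?\<phi> ?\<phi> ` parcs ?K - Id" using V(3) by blast
  next
    fix i j assume "(i, j) \<in> map_prod ?\<phi> ?\<phi> ` parcs ?K - Id"
    then obtain x y where "(x, y) \<in> parcs ?K" "i = ?\<phi> x" "j = ?\<phi> y" "i \<noteq> j" by auto
    then show "(i, j) \<in> parcs X" using index by (auto simp: model_graph_def)
  qed
  moreover have "connected_on (parcs ?K) {v \<in> pverts ?K. ?\<phi> v = i}" if "i \<in> pverts X" for i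
    unfolding fibre[OF that]
    by (rule connected_on_edges_mono[OF M(2)[OF that]]) (use that in \<open>auto simp: model_graph_def\<close>)
  ultimately show ?thesis by (simp add: contraction_map_def)
qed

lemma minor_model_imp_is_minor:
  fixes G :: "'a pair_pre_digraph" and X :: "'b pair_pre_digraph"
  assumes "pair_graph G" "pair_graph X" "minor_model X (pverts G) (parcs G) M"
  shows "is_minor X G"
proof -
  let ?K = "model_graph X (parcs G) M"
  have K: "pair_graph ?K" by (rule pair_graph_model_graph[OF assms])
  have "subgraph (with_proj ?K) (with_proj G)"
    by (rule subgraph_with_projI[OF assms(1) K])
      (use assms(3) in \<open>auto simp: model_graph_def minor_model_def connected_subset_def\<close>)
  moreover obtain K' where "contracts_to ?K K'" "digraph_iso (with_proj X) (with_proj K')"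
    using contraction_map_imp_contracts_to[OF K contraction_map_model_index[OF assms(2,3)]] by blast
  ultimately show ?thesis unfolding is_minor_def using K by blast
qed

definition clique_model :: "'a rel \<Rightarrow> 'a set \<Rightarrow> 'i set \<Rightarrow> ('i \<Rightarrow> 'a set) \<Rightarrow> bool" where
  "clique_model E U Q B \<longleftrightarrow>
     finite Q \<and> (\<forall>r\<in>Q. connected_subset E U (B r)) \<and>
     (\<forall>r\<in>Q. \<forall>q\<in>Q. r \<noteq> q \<longrightarrow> B r \<inter> B q = {} \<and> touches E (B r) (B q))"

lemma clique_modelD:
  assumes "clique_model E U Q B"
  shows "finite Q" "r \<in> Q \<Longrightarrow> connected_subset E U (B r)"
    "r \<in> Q \<Longrightarrow> q \<in> Q \<Longrightarrow> r \<noteq> q \<Longrightarrow> B r \<inter> B q = {} \<and> touches E (B r) (B q)"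
  using assms by (simp_all add: clique_model_def)

lemma clique_model_subset:
  assumes "clique_model E U Q B" "Q' \<subseteq> Q" "U \<subseteq> U'"
  shows "clique_model E U' Q' B"
  unfolding clique_model_def
proof (intro conjI ballI impI)
  note Q = subsetD[OF assms(2)]
  show "finite Q'" using assms(2) clique_modelD(1)[OF assms(1)] by (rule finite_subset)
  show "connected_subset E U' (B r)" if "r \<in> Q'" for r
    using clique_modelD(2)[OF assms(1) Q[OF that]] assms(3) by (auto simp: connected_subset_def)
  fix r q assume "r \<in> Q'" "q \<in> Q'" "r \<noteq> q"
  then show "B r \<inter> B q = {}" "touches E (B r) (B q)"
    using clique_modelD(3)[OF assms(1) Q Q] by simp_all
qed

lemma clique_model_insert:
  assumes "sym E" "clique_model E U Q B" "k \<notin> Q" "connected_subset E U D"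
    and D: "\<And>r. r \<in> Q \<Longrightarrow> D \<inter> B r = {} \<and> touches E D (B r)"
  shows "clique_model E U (insert k Q) (B(k := D))"
  unfolding clique_model_def
proof (intro conjI ballI impI)
  note B = clique_modelD[OF assms(2)]
  show "finite (insert k Q)" using B(1) by simp
  show "connected_subset E U ((B(k := D)) r)" if "r \<in> insert k Q" for r
    using B(2) assms(4) that by auto
  have D': "B r \<inter> D = {} \<and> touches E (B r) D" if "r \<in> Q" for r
    using D[OF that] touches_sym[OF assms(1)] by blast
  fix r q assume "r \<in> insert k Q" "q \<in> insert k Q" "r \<noteq> q"
  then show "(B(k := D)) r \<inter> (B(k := D)) q = {}" "touches E ((B(k := D)) r) ((B(k := D)) q)"
    using B(3)[of r q] D[of q] D'[of r] by auto
qed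

lemma K_star_simps [simp]:
  "pverts (K_star s t) = {..<s + t}"
  "parcs (K_star s t) =
     {(u, v). u < s \<and> v < s \<and> u \<noteq> v} \<union> {..<s} \<times> {s..<s + t} \<union> {s..<s + t} \<times> {..<s}"
  by (auto simp: K_star_def Let_def)

lemma pair_graph_K_star: "pair_graph (K_star s t)"
  by (rule pair_graphI) (auto simp: sym_def irrefl_def)

lemma K_star_minor_modelI:
  assumes "sym E" and connected: "\<And>i. i < s + t \<Longrightarrow> connected_subset E V (M i)"
    and disj: "\<And>i j. i < j \<Longrightarrow> j < s + t \<Longrightarrow> M i \<inter> M j = {}"
    and touch: "\<And>i j. i < j \<Longrightarrow> j < s + t \<Longrightarrow> i < s \<Longrightarrow> touches E (M i) (M j)"
  shows "minor_model (K_star s t) V E M"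
proof -
  have "M i \<inter> M j = {}" if "i < s + t" "j < s + t" "i \<noteq> j" for i j
    using disj[of i j] disj[of j i] that by (cases "i < j") (simp_all add: Int_commute)
  then have "disjoint_family_on M (pverts (K_star s t))" by (simp add: disjoint_family_on_def)
  moreover have "touches E (M i) (M j)" if "(i, j) \<in> parcs (K_star s t)" for i j
  proof -
    have "i < j \<and> j < s + t \<and> i < s \<or> j < i \<and> i < s + t \<and> j < s" using that by auto
    then show ?thesis
      using touch[of i j] touch[of j i] touches_sym[OF assms(1), of "M i" "M j"] by blast
  qed
  ultimately show ?thesis using connected by (auto simp: minor_model_def simp del: K_star_simps(2))
qed

lemma clique_model_imp_K_star_model:
  assumes "sym E" and B: "clique_model E V Q B" "card Q = s"
    and \<D>: "finite \<D>" "card \<D> = t" "disjoint \<D>"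
    and D: "\<And>D. D \<in> \<D> \<Longrightarrow> connected_subset E V D"
      "\<And>D r. D \<in> \<D> \<Longrightarrow> r \<in> Q \<Longrightarrow> D \<inter> B r = {} \<and> touches E D (B r)"
  obtains M where "minor_model (K_star s t) V E M"
proof -
  obtain g where g: "bij_betw g {..<s} Q"
    using finite_same_card_bij[of "{..<s}" Q] clique_modelD(1)[OF B(1)] B(2) by auto
  obtain h where h: "bij_betw h {s..<s + t} \<D>"
    using finite_same_card_bij[of "{s..<s + t}" \<D>] \<D>(1,2) by auto
  define M where "M i = (if i < s then B (g i) else h i)" for i
  have clique: "M i = B (g i)" "g i \<in> Q" if "i < s" for i
    using bij_betwE[OF g] that by (simp_all add: M_def)
  have independent: "M i = h i" "h i \<in> \<D>" if "s \<le> i" "i < s + t" for i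
    using bij_betwE[OF h] that by (simp_all add: M_def)
  have "minor_model (K_star s t) V E M"
  proof (rule K_star_minor_modelI[OF assms(1)])
    fix i assume "i < s + t"
    then show "connected_subset E V (M i)"
      using clique[of i] independent[of i] clique_modelD(2)[OF B(1)] D(1) by (cases "i < s") simp_all
  next
    fix i j assume ij: "i < j" "j < s + t"
    have disjoint_touches: "M i \<inter> M j = {} \<and> touches E (M i) (M j)" if "i < s"
    proof (cases "j < s")
      case True
      then have "g i \<noteq> g j" using inj_on_eq_iff[OF bij_betw_imp_inj_on[OF g], of i j] ij(1) by simp
      then show ?thesis using clique_modelD(3)[OF B(1)] clique \<open>i < s\<close> True by simp
    next
      case False
      then have "M j \<inter> M i = {} \<and> touches E (M j) (M i)"
        using D(2) clique[OF \<open>i < s\<close>] independent[of j] ij(2) by simp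
      then show ?thesis using touches_sym[OF assms(1), of "M i" "M j"] by blast
    qed
    then show "touches E (M i) (M j)" if "i < s" using that by blast
    show "M i \<inter> M j = {}"
    proof (cases "i < s")
      case False
      then have "h i \<noteq> h j" using inj_on_eq_iff[OF bij_betw_imp_inj_on[OF h], of i j] ij by simp
      then show ?thesis
        using \<D>(3) independent[of i] independent[of j] False ij by (simp add: pairwise_def disjnt_def)
    qed (use disjoint_touches in blast)
  qed
  then show ?thesis by (rule that)
qed

section \<open>Graph partitions and elimination orders\<close>

text \<open>The classes \<open>{v \<in> A. f v = i}\<close> form an \<open>H\<close>-partition of the subgraph induced by \<open>A\<close>.\<close>
definition graph_partition :: "'a rel \<Rightarrow> 'a set \<Rightarrow> 'b pair_pre_digraph \<Rightarrow> ('a \<Rightarrow> 'b) \<Rightarrow> bool" where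
  "graph_partition E A H f \<longleftrightarrow>
     (\<forall>v\<in>A. f v \<in> pverts H) \<and>
     (\<forall>u\<in>A. \<forall>v\<in>A. (u, v) \<in> E \<longrightarrow> f u = f v \<or> (f u, f v) \<in> parcs H)"

text \<open>
  \<open>R i\<close> contains the earlier neighbours of \<open>i\<close>. The condition \<open>R i \<subseteq> insert p (R p)\<close> makes the sets
  \<open>insert i (R i)\<close> the bags of a tree-decomposition.
\<close>
definition elimination_order :: "nat \<Rightarrow> nat \<Rightarrow> (nat \<Rightarrow> nat set) \<Rightarrow> bool" where
  "elimination_order s k R \<longleftrightarrow>
     0 < k \<and> (\<forall>i<k. R i \<subseteq> {..<i} \<and> card (R i) \<le> s \<and> (0 < i \<longrightarrow> (\<exists>p<i. R i \<subseteq> insert p (R p))))"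

definition order_graph :: "nat \<Rightarrow> (nat \<Rightarrow> nat set) \<Rightarrow> nat pair_pre_digraph" where
  "order_graph k R = \<lparr> pverts = {..<k}, parcs = {(i, j). i < k \<and> j < k \<and> (i \<in> R j \<or> j \<in> R i)} \<rparr>"

lemma order_graph_simps [simp]:
  "pverts (order_graph k R) = {..<k}"
  "(i, j) \<in> parcs (order_graph k R) \<longleftrightarrow> i < k \<and> j < k \<and> (i \<in> R j \<or> j \<in> R i)"
  by (simp_all add: order_graph_def)

lemma graph_partitionD:
  assumes "graph_partition E S H f"
  shows "v \<in> S \<Longrightarrow> f v \<in> pverts H"
    "u \<in> S \<Longrightarrow> v \<in> S \<Longrightarrow> (u, v) \<in> E \<Longrightarrow> f u = f v \<or> (f u, f v) \<in> parcs H"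
  using assms by (simp_all add: graph_partition_def)

lemma elimination_orderD:
  assumes "elimination_order s k R" "i < k"
  shows "R i \<subseteq> {..<i}" "card (R i) \<le> s" "0 < i \<Longrightarrow> \<exists>p<i. R i \<subseteq> insert p (R p)"
  using assms by (simp_all add: elimination_order_def)

lemma elimination_order_extend:
  assumes R: "elimination_order s k R" and "p < k" "Q \<subseteq> insert p (R p)" "card Q \<le> s"
  shows "elimination_order s (Suc k) (R(k := Q))"
proof -
  let ?R = "R(k := Q)"
  have "?R i \<subseteq> {..<i} \<and> card (?R i) \<le> s \<and> (0 < i \<longrightarrow> (\<exists>p<i. ?R i \<subseteq> insert p (?R p)))"
    if "i < Suc k" for i
  proof (cases "i = k")
    case True
    have "Q \<subseteq> {..<k}" using elimination_orderD(1)[OF R assms(2)] assms(2,3) by force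
    then show ?thesis using True assms(2-4) by auto
  next
    case False
    then have "i < k" using that by simp
    moreover have "?R p = R p" if "p < i" for p using that \<open>i < k\<close> by simp
    ultimately show ?thesis
      using elimination_orderD[OF R \<open>i < k\<close>] by (metis fun_upd_other nat_neq_iff)
  qed
  then show ?thesis by (simp add: elimination_order_def del: fun_upd_apply)
qed

lemma graph_partition_extend:
  assumes "sym E" and f: "graph_partition E A (order_graph k R) f" and "X \<inter> A = {}"
    and nbs: "\<And>u v. u \<in> X \<Longrightarrow> v \<in> A \<Longrightarrow> (u, v) \<in> E \<Longrightarrow> f v \<in> Q"
  shows "graph_partition E (A \<union> X) (order_graph (Suc k) (R(k := Q))) (override_on f (\<lambda>_. k) X)"
proof -
  let ?f = "override_on f (\<lambda>_. k) X" and ?H = "order_graph (Suc k) (R(k := Q))"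
  have f_A: "?f v = f v" "f v < k" if "v \<in> A" for v
  proof -
    have "v \<notin> X" using that assms(3) by blast
    then show "?f v = f v" by simp
    show "f v < k" using graph_partitionD(1)[OF f that] by simp
  qed
  have f_X: "?f v = k" if "v \<in> X" for v using that by simp
  have XA: "(k, f v) \<in> parcs ?H \<and> (f v, k) \<in> parcs ?H" if "u \<in> X" "v \<in> A" "(u, v) \<in> E" for u v
    using nbs[OF that] f_A(2)[OF that(2)] by simp
  have "?f u = ?f v \<or> (?f u, ?f v) \<in> parcs ?H" if uv: "u \<in> A \<union> X" "v \<in> A \<union> X" "(u, v) \<in> E" for u v
  proof -
    consider "u \<in> A" "v \<in> A" | "u \<in> X" "v \<in> X" | "u \<in> X" "v \<in> A" | "u \<in> A" "v \<in> X"
      using uv by blast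
    then show ?thesis
    proof cases
      case 1
      then have "f u = f v \<or> (f u, f v) \<in> parcs (order_graph k R)"
        by (rule graph_partitionD(2)[OF f _ _ uv(3)])
      then show ?thesis using f_A[OF 1(1)] f_A[OF 1(2)] by auto
    next
      case 2
      then show ?thesis by simp
    next
      case 3
      then show ?thesis using XA[OF 3 uv(3)] by (simp add: f_A(1) del: order_graph_simps)
    next
      case 4
      then show ?thesis
        using XA[OF 4(2,1) symD[OF assms(1) uv(3)]] by (simp add: f_A(1) del: order_graph_simps)
    qed
  qed
  moreover have "?f v \<in> pverts ?H" if "v \<in> A \<union> X" for v
    using that f_A[of v] f_X[of v] by (cases "v \<in> X") auto
  ultimately show ?thesis unfolding graph_partition_def by blast
qed

lemma covered_parts_extend:
  assumes "\<And>i. i < k \<Longrightarrow> covered W I q {v \<in> A. f v = i}" "covered W I q X"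
    and f: "graph_partition E A (order_graph k R) f" and "i < Suc k"
  shows "covered W I q {v \<in> A \<union> X. override_on f (\<lambda>_. k) X v = i}"
proof (cases "i = k")
  case True
  have "f v \<noteq> k" if "v \<in> A" for v using graph_partitionD(1)[OF f that] by simp
  then have "{v \<in> A \<union> X. override_on f (\<lambda>_. k) X v = i} \<subseteq> X"
    using True by (auto simp: override_on_def)
  then show ?thesis by (rule covered_mono[OF assms(2) _ order_refl])
next
  case False
  then have "{v \<in> A \<union> X. override_on f (\<lambda>_. k) X v = i} \<subseteq> {v \<in> A. f v = i}"
    by (auto simp: override_on_def)
  moreover have "i < k" using assms(4) False by simp
  ultimately show ?thesis using covered_mono[OF assms(1)] by blast
qed

section \<open>Partitions into parts covered by few bags\<close>

context rooted_tree_decomposition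
begin

text \<open>
  \<open>C\<close> is a set of uncovered vertices whose neighbours lie in the parts \<open>r \<in> Q\<close>; the branch set \<open>B r\<close>
  contains the neighbours in part \<open>r\<close>, but may use uncovered vertices as well.
\<close>
definition attachment :: "('a \<Rightarrow> nat) \<Rightarrow> 'a set \<Rightarrow> nat set \<Rightarrow> (nat \<Rightarrow> 'a set) \<Rightarrow> bool" where
  "attachment f C Q B \<longleftrightarrow>
     clique_model E (V - C) Q B \<and> (\<forall>r\<in>Q. touches E C (B r)) \<and>
     (\<forall>c\<in>C. \<forall>y. (c, y) \<in> E \<longrightarrow> y \<notin> C \<longrightarrow> f y \<in> Q \<and> y \<in> B (f y))"

definition attachable :: "nat \<Rightarrow> ('a \<Rightarrow> nat) \<Rightarrow> nat set \<Rightarrow> 'a set \<Rightarrow> bool" where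
  "attachable s f P C \<longleftrightarrow> (\<exists>Q B. Q \<subseteq> P \<and> card Q \<le> s \<and> attachment f C Q B)"

definition full_subsets :: "'a set \<Rightarrow> nat set \<Rightarrow> (nat \<Rightarrow> 'a set) \<Rightarrow> 'a set set" where
  "full_subsets C Q B = {D. connected_subset E C D \<and> (\<forall>r\<in>Q. touches E D (B r))}"

text \<open>
  Deleting \<open>X\<close> may leave a component touching all branch sets only if there are fewer than \<open>s\<close> of
  them, in which case \<open>D\<close> can serve as a further branch set for that component.
\<close>
definition separator :: "nat \<Rightarrow> 'a set \<Rightarrow> nat set \<Rightarrow> (nat \<Rightarrow> 'a set) \<Rightarrow> 'a set \<Rightarrow> bool" where
  "separator s C Q B X \<longleftrightarrow> X \<subseteq> C \<and>
     (\<forall>C'. component E (C - X) C' \<longrightarrow> C' \<in> full_subsets C Q B \<longrightarrow>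
        card Q < s \<and> (\<exists>D\<in>full_subsets C Q B. X \<subseteq> D \<and> D \<inter> C' = {}))"

definition minimal_separator :: "nat \<Rightarrow> 'a set \<Rightarrow> nat set \<Rightarrow> (nat \<Rightarrow> 'a set) \<Rightarrow> 'a set \<Rightarrow> bool" where
  "minimal_separator s C Q B X \<longleftrightarrow>
     separator s C Q B X \<and> (\<forall>X'. X' \<subset> X \<longrightarrow> \<not> separator s C Q B X')"

text \<open>\<open>D\<close> can serve as the branch set of the part \<open>X\<close> in an attachment of \<open>C'\<close>.\<close>
definition new_branch_set ::
    "'a set \<Rightarrow> nat set \<Rightarrow> (nat \<Rightarrow> 'a set) \<Rightarrow> 'a set \<Rightarrow> 'a set \<Rightarrow> bool" where
  "new_branch_set C' Q B X D \<longleftrightarrow> connected_subset E (V - C') D \<and> X \<subseteq> D \<and>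
     (\<forall>r\<in>Q. touches E C' (B r) \<longrightarrow> D \<inter> B r = {} \<and> touches E D (B r))"

lemma attachmentD:
  assumes "attachment f C Q B"
  shows "clique_model E (V - C) Q B" "r \<in> Q \<Longrightarrow> touches E C (B r)"
    "c \<in> C \<Longrightarrow> (c, y) \<in> E \<Longrightarrow> y \<notin> C \<Longrightarrow> f y \<in> Q \<and> y \<in> B (f y)"
  using assms by (simp_all add: attachment_def)

lemma attachment_cong:
  assumes att: "attachment f C Q B"
    and eq: "\<And>c y. c \<in> C \<Longrightarrow> (c, y) \<in> E \<Longrightarrow> y \<notin> C \<Longrightarrow> f' y = f y"
  shows "attachment f' C Q B"
  unfolding attachment_def
proof (intro conjI ballI allI impI)
  fix c y assume "c \<in> C" "(c, y) \<in> E" "y \<notin> C"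
  then show "f' y \<in> Q" "y \<in> B (f' y)" using attachmentD(3)[OF att] eq by simp_all
qed (use attachmentD(1,2)[OF att] in simp_all)

lemma component_touches_separator:
  assumes C: "connected_subset E V C" and "X \<subseteq> C" "X \<noteq> {}" and C': "component E (C - X) C'"
  shows "touches E C' X"
proof -
  obtain x y where xy: "x \<in> C'" "y \<in> X" using componentD(2)[OF C'] assms(3) by blast
  then have "x \<in> C" "y \<in> C" "y \<notin> C'" using componentD(1)[OF C'] assms(2) by auto
  then obtain u v where uv: "u \<in> C \<inter> C'" "v \<in> C - C'" "(u, v) \<in> E"
    using connected_on_crossing[OF _ _ xy(1)] C unfolding connected_subset_def by metis
  then have "v \<in> X" using componentD(4)[OF C' _ uv(3)] by blast
  then show ?thesis using uv by (auto simp: touches_def)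
qed

lemma attachment_extend:
  assumes C: "connected_subset E V C" and att: "attachment f C Q B" and "k \<notin> Q"
    and X: "X \<subseteq> C" "X \<noteq> {}" and C': "component E (C - X) C'"
    and new: "new_branch_set C' Q B X D"
  shows "attachment (override_on f (\<lambda>_. k) X) C' (insert k {r \<in> Q. touches E C' (B r)}) (B(k := D))"
    (is "attachment ?f C' (insert k ?Q) ?B")
  unfolding attachment_def
proof (intro conjI ballI allI impI)
  have D: "connected_subset E (V - C') D" "X \<subseteq> D"
    and DB: "\<forall>r\<in>Q. touches E C' (B r) \<longrightarrow> D \<inter> B r = {} \<and> touches E D (B r)"
    using new by (simp_all add: new_branch_set_def)
  have "C' \<subseteq> C" using componentD(1)[OF C'] by blast
  then have "clique_model E (V - C') ?Q B"
    by (intro clique_model_subset[OF attachmentD(1)[OF att]]) auto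
  then show "clique_model E (V - C') (insert k ?Q) ?B"
    by (rule clique_model_insert[OF sym_E]) (use D(1) DB assms(3) in auto)
  have "touches E C' D"
    by (rule touches_mono[OF component_touches_separator[OF C X C'] order_refl D(2)])
  then show "touches E C' (?B r)" if "r \<in> insert k ?Q" for r using that by auto
  fix c y assume cy: "c \<in> C'" "(c, y) \<in> E" "y \<notin> C'"
  have "?f y \<in> insert k ?Q \<and> y \<in> ?B (?f y)"
  proof (cases "y \<in> X")
    case True
    then show ?thesis using D(2) by auto
  next
    case False
    then have "y \<notin> C" using componentD(4)[OF C' cy(1,2)] cy(3) by blast
    then have y: "f y \<in> Q" "y \<in> B (f y)" using attachmentD(3)[OF att _ cy(2)] cy(1) \<open>C' \<subseteq> C\<close> by auto
    then have "touches E C' (B (f y))" using cy(1,2) by (auto simp: touches_def)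
    then show ?thesis using y False assms(3) by auto
  qed
  then show "?f y \<in> insert k ?Q" "y \<in> ?B (?f y)" by simp_all
qed

lemma full_subset_connected: "D \<in> full_subsets C Q B \<Longrightarrow> connected_subset E C D"
  by (simp add: full_subsets_def)

lemma attached_set_full:
  assumes "connected_subset E V C" "attachment f C Q B"
  shows "C \<in> full_subsets C Q B"
  using assms(1) attachmentD(2)[OF assms(2)] by (simp add: full_subsets_def connected_subset_def)

lemma separator_nonempty:
  assumes "C \<in> full_subsets C Q B" "separator s C Q B X"
  shows "X \<noteq> {}"
proof
  assume "X = {}"
  have C: "connected_subset E C C" by (rule full_subset_connected[OF assms(1)])
  then have "component E (C - X) C" by (simp add: component_def \<open>X = {}\<close>)
  then obtain D where "D \<in> full_subsets C Q B" "D \<inter> C = {}"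
    using assms unfolding separator_def by blast
  then show False by (auto simp: full_subsets_def connected_subset_def)
qed

lemma few_branch_sets_separator:
  assumes "C \<subseteq> V" "C \<in> full_subsets C Q B" "card Q < s"
  obtains X where "separator s C Q B X" "covered W {..<n} 1 X"
proof -
  let ?\<F> = "full_subsets C Q B"
  have nonempty: "?\<F> \<noteq> {}" using assms(2) by blast
  have upward: "D' \<in> ?\<F>" if "D \<in> ?\<F>" "D \<subseteq> D'" "connected_subset E C D'" for D D'
    using that touches_mono[OF _ that(2) order_refl] by (simp add: full_subsets_def)
  obtain D z where D: "D \<in> ?\<F>" "z < n"
    and sep: "\<forall>C'. component E (C - D \<inter> W z) C' \<longrightarrow> C' \<in> ?\<F> \<longrightarrow> D \<inter> C' = {}"
    by (rule separating_bag[OF assms(1) nonempty full_subset_connected upward])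
  have "D \<inter> W z \<subseteq> C" using full_subset_connected[OF D(1)] by (auto simp: connected_subset_def)
  moreover have "card Q < s \<and> (\<exists>D'\<in>?\<F>. D \<inter> W z \<subseteq> D' \<and> D' \<inter> C' = {})"
    if "component E (C - D \<inter> W z) C'" "C' \<in> ?\<F>" for C'
    using assms(3) D(1) sep that by blast
  ultimately have "separator s C Q B (D \<inter> W z)" by (simp add: separator_def)
  moreover have "covered W {..<n} 1 (D \<inter> W z)"
    using covered_mono[OF covered_bag[of z "{..<n}" W], of "D \<inter> W z" 1] D(2) by simp
  ultimately show ?thesis by (rule that)
qed

lemma K_star_minor_free_separator:
  assumes "C \<subseteq> V" and B: "clique_model E (V - C) Q B"
    and free: "\<nexists>M. minor_model (K_star (card Q) (Suc q)) V E M"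
  obtains X where "separator s C Q B X" "covered W {..<n} q X"
proof -
  let ?\<F> = "full_subsets C Q B"
  have \<F>: "connected_subset E V D" if "D \<in> ?\<F>" for D
    using full_subset_connected[OF that] assms(1) by (auto simp: connected_subset_def)
  have "\<not> (\<exists>\<D>\<subseteq>?\<F>. card \<D> = Suc q \<and> disjoint \<D>)"
  proof
    assume "\<exists>\<D>\<subseteq>?\<F>. card \<D> = Suc q \<and> disjoint \<D>"
    then obtain \<D> where \<D>: "\<D> \<subseteq> ?\<F>" "card \<D> = Suc q" "disjoint \<D>" by blast
    have clique: "clique_model E V Q B" by (rule clique_model_subset[OF B]) auto
    have "finite \<D>" using \<D>(2) card.infinite by force
    show False
    proof (rule clique_model_imp_K_star_model[OF sym_E clique HOL.refl \<open>finite \<D>\<close> \<D>(2,3)])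
      fix D assume "D \<in> \<D>"
      then have D: "D \<in> ?\<F>" by (rule subsetD[OF \<D>(1)])
      then show "connected_subset E V D" by (rule \<F>)
      fix r assume "r \<in> Q"
      then have "D \<subseteq> C" "B r \<subseteq> V - C" "touches E D (B r)"
        using D clique_modelD(2)[OF B] by (simp_all add: full_subsets_def connected_subset_def)
      then show "D \<inter> B r = {} \<and> touches E D (B r)" by blast
    qed (use free in blast)
  qed
  moreover have "packing_or_hitting_bags q ?\<F>"
    by (rule packing_or_hitting_bags_connected_subsets[OF \<F>])
  ultimately obtain X where X: "covered W {..<n} q X" and hits: "\<forall>D\<in>?\<F>. D \<inter> X \<noteq> {}"
    unfolding packing_or_hitting_bags_def by blast
  have "C' \<notin> ?\<F>" if C': "component E (C - C \<inter> X) C'" for C'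
  proof
    assume "C' \<in> ?\<F>"
    then have "C' \<inter> X \<noteq> {}" using hits by simp
    then show False using componentD(1)[OF C'] by blast
  qed
  then have "separator s C Q B (C \<inter> X)" by (simp add: separator_def)
  moreover have "covered W {..<n} q (C \<inter> X)" by (rule covered_mono[OF X]) simp_all
  ultimately show ?thesis by (rule that)
qed

lemma minimal_separator_exists:
  assumes "finite C" "separator s C Q B X"
  obtains Y where "Y \<subseteq> X" "minimal_separator s C Q B Y"
proof -
  define A where "A = {Y \<in> Pow C. separator s C Q B Y}"
  have "finite A" using assms(1) by (simp add: A_def)
  moreover have "X \<in> A" using assms(2) by (simp add: A_def separator_def)
  ultimately obtain Y where Y: "Y \<in> A" "Y \<subseteq> X" and min: "\<forall>X'\<in>A. X' \<subseteq> Y \<longrightarrow> Y = X'"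
    using finite_has_minimal2[of A X] by blast
  have "\<not> separator s C Q B X'" if "X' \<subset> Y" for X'
  proof
    assume "separator s C Q B X'"
    then have "X' \<in> A" by (simp add: A_def separator_def)
    then show False using min that by blast
  qed
  then have "minimal_separator s C Q B Y" using Y(1) by (simp add: minimal_separator_def A_def)
  with Y(2) show ?thesis by (rule that)
qed

lemma separator_Diff:
  assumes X: "separator s C Q B X" and U: "component E (C - (X - K)) U" "U \<notin> full_subsets C Q B"
    and "K \<subseteq> U"
  shows "separator s C Q B (X - K)"
  unfolding separator_def
proof (intro conjI allI impI)
  show "X - K \<subseteq> C" using X by (auto simp: separator_def)
  fix C' assume C': "component E (C - (X - K)) C'" "C' \<in> full_subsets C Q B"
  then have disj: "C' \<inter> U = {}" using component_eq_or_disjoint[OF C'(1) U(1)] U(2) by blast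
  have "component E (C - X) C'"
  proof (rule componentI[OF _ componentD(2,3)[OF C'(1)]])
    show "C' \<subseteq> C - X" using componentD(1)[OF C'(1)] disj assms(4) by blast
    show "b \<in> C'" if "a \<in> C'" "(a, b) \<in> E" "b \<in> C - X" for a b
      using componentD(4)[OF C'(1) that(1,2)] that(3) by blast
  qed
  then have "card Q < s \<and> (\<exists>D\<in>full_subsets C Q B. X \<subseteq> D \<and> D \<inter> C' = {})"
    using X C'(2) by (simp add: separator_def)
  then show "card Q < s" "\<exists>D\<in>full_subsets C Q B. X - K \<subseteq> D \<and> D \<inter> C' = {}" by auto
qed

text \<open>Otherwise \<open>K\<close> could be removed from the separator.\<close>
lemma minimal_separator_component_touches:
  assumes sep: "minimal_separator s C Q B X" and C: "connected_subset E V C"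
    and C': "component E (C - X) C'" and r: "r \<in> Q" "\<not> touches E C' (B r)"
    and K: "component E (C - C') K"
  shows "touches E K (B r)"
proof (rule ccontr)
  assume no_touch: "\<not> touches E K (B r)"
  have X: "separator s C Q B X" using sep by (simp add: minimal_separator_def)
  have "C' \<subseteq> C" "K \<subseteq> C" "K \<inter> C' = {}" using componentD(1)[OF C'] componentD(1)[OF K] by auto
  obtain x c where xc: "x \<in> K" "c \<in> C'" using componentD(2)[OF K] componentD(2)[OF C'] by blast
  then have "x \<in> C" "c \<in> C" "c \<notin> K" using \<open>C' \<subseteq> C\<close> \<open>K \<subseteq> C\<close> \<open>K \<inter> C' = {}\<close> by auto
  then obtain u v where uv: "u \<in> C \<inter> K" "v \<in> C - K" "(u, v) \<in> E"
    using connected_on_crossing[OF _ _ xc(1)] C unfolding connected_subset_def by metis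
  have "v \<in> C'" using componentD(4)[OF K _ uv(3)] uv(1,2) by blast
  have "u \<in> X"
    using componentD(4)[OF C' \<open>v \<in> C'\<close> symD[OF sym_E uv(3)]] uv(1) \<open>K \<inter> C' = {}\<close> by blast
  have union: "component E (C - (X - K)) (C' \<union> K)"
  proof (rule componentI)
    show "C' \<union> K \<subseteq> C - (X - K)" using componentD(1)[OF C'] \<open>K \<subseteq> C\<close> by blast
    show "C' \<union> K \<noteq> {}" using xc by blast
    have "touches E K C'" using uv \<open>v \<in> C'\<close> by (auto simp: touches_def)
    then show "connected_on E (C' \<union> K)"
      using connected_on_Un[OF sym_E componentD(3)[OF K] componentD(3)[OF C']]
      by (simp add: Un_commute)
    fix a b assume ab: "a \<in> C' \<union> K" "(a, b) \<in> E" "b \<in> C - (X - K)"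
    show "b \<in> C' \<union> K"
      using componentD(4)[OF C' _ ab(2)] componentD(4)[OF K _ ab(2)] ab(1,3) by blast
  qed
  have "\<not> touches E (C' \<union> K) (B r)" using no_touch r(2) by (auto simp: touches_def)
  then have "C' \<union> K \<notin> full_subsets C Q B" using r(1) by (auto simp: full_subsets_def)
  then have "separator s C Q B (X - K)" by (rule separator_Diff[OF X union]) simp
  moreover have "X - K \<subset> X" using \<open>u \<in> X\<close> uv(1) by blast
  ultimately show False using sep by (simp add: minimal_separator_def)
qed

lemma minimal_separator_branch_set_connected:
  assumes sep: "minimal_separator s C Q B X" and C: "connected_subset E V C"
    and C': "component E (C - X) C'" and r: "r \<in> Q" "\<not> touches E C' (B r)"
    and Br: "connected_subset E U (B r)"
  shows "connected_on E (B r \<union> (C - C'))"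
proof (rule connected_on_Un_attached[OF sym_E])
  show "connected_on E (B r)" "B r \<noteq> {}" using Br by (simp_all add: connected_subset_def)
  have "finite C" using C finite_V finite_subset by (auto simp: connected_subset_def)
  fix x assume "x \<in> C - C'"
  then obtain K where K: "component E (C - C') K" "x \<in> K"
    using component_containing[OF sym_E finite_Diff[OF \<open>finite C\<close>]] by metis
  then show "\<exists>D\<subseteq>C - C'. x \<in> D \<and> connected_on E D \<and> touches E D (B r)"
    using componentD(1,3)[OF K(1)] minimal_separator_component_touches[OF sep C C' r K(1)] by blast
qed

lemma full_component_new_branch_set:
  assumes sep: "separator s C Q B X" and "C \<subseteq> V" and B: "clique_model E (V - C) Q B"
    and C': "component E (C - X) C'" "C' \<in> full_subsets C Q B"
  obtains D where "new_branch_set C' Q B X D" "card Q < s"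
proof -
  have "card Q < s" "\<exists>D\<in>full_subsets C Q B. X \<subseteq> D \<and> D \<inter> C' = {}"
    using sep C' by (simp_all add: separator_def)
  then obtain D where D: "D \<in> full_subsets C Q B" "X \<subseteq> D" "D \<inter> C' = {}" by blast
  have "connected_subset E (V - C') D"
    using D(1,3) assms(2) by (auto simp: full_subsets_def connected_subset_def)
  moreover have "D \<inter> B r = {} \<and> touches E D (B r)" if "r \<in> Q" for r
  proof -
    have "D \<subseteq> C" "B r \<subseteq> V - C" "touches E D (B r)"
      using D(1) clique_modelD(2)[OF B that] that
      by (simp_all add: full_subsets_def connected_subset_def)
    then show ?thesis by blast
  qed
  ultimately have "new_branch_set C' Q B X D" using D(2) by (simp add: new_branch_set_def)
  then show ?thesis using \<open>card Q < s\<close> by (rule that)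
qed

lemma enlarged_branch_set_new_branch_set:
  assumes sep: "minimal_separator s C Q B X" and C: "connected_subset E V C"
    and B: "clique_model E (V - C) Q B"
    and C': "component E (C - X) C'" and q: "q \<in> Q" "\<not> touches E C' (B q)"
  shows "new_branch_set C' Q B X (B q \<union> (C - C'))"
  unfolding new_branch_set_def
proof (intro conjI ballI impI)
  let ?D = "B q \<union> (C - C')"
  note Bq = clique_modelD(2)[OF B q(1)]
  have "connected_on E ?D" by (rule minimal_separator_branch_set_connected[OF sep C C' q Bq])
  moreover have "?D \<subseteq> V - C'" "?D \<noteq> {}"
    using Bq C componentD(1)[OF C'] by (auto simp: connected_subset_def)
  ultimately show "connected_subset E (V - C') ?D" by (simp add: connected_subset_def)
  show "X \<subseteq> ?D" using sep componentD(1)[OF C'] by (auto simp: minimal_separator_def separator_def)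
  fix r assume r: "r \<in> Q" "touches E C' (B r)"
  have "q \<noteq> r" using q(2) r(2) by blast
  then have Bqr: "B q \<inter> B r = {}" "touches E (B q) (B r)"
    using clique_modelD(3)[OF B q(1) r(1)] by auto
  have "C \<inter> B r = {}" using clique_modelD(2)[OF B r(1)] by (auto simp: connected_subset_def)
  then show "?D \<inter> B r = {}" using Bqr(1) by blast
  show "touches E ?D (B r)" by (rule touches_mono[OF Bqr(2)]) simp_all
qed

lemma new_branch_set_exists:
  assumes sep: "minimal_separator s C Q B X" and C: "connected_subset E V C"
    and B: "clique_model E (V - C) Q B" "card Q \<le> s" and C': "component E (C - X) C'"
  obtains D where "new_branch_set C' Q B X D" "card {r \<in> Q. touches E C' (B r)} < s"
proof (cases "C' \<in> full_subsets C Q B")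
  case True
  have "separator s C Q B X" "C \<subseteq> V"
    using sep C by (simp_all add: minimal_separator_def connected_subset_def)
  then obtain D where D: "new_branch_set C' Q B X D" "card Q < s"
    by (rule full_component_new_branch_set[OF _ _ B(1) C' True])
  have "card {r \<in> Q. touches E C' (B r)} \<le> card Q"
    by (rule card_mono) (use clique_modelD(1)[OF B(1)] in auto)
  then show ?thesis using D(2) by (intro that[OF D(1)]) simp
next
  case False
  have "connected_subset E C C'" using componentD(1-3)[OF C'] by (auto simp: connected_subset_def)
  then obtain q where q: "q \<in> Q" "\<not> touches E C' (B q)" using False by (auto simp: full_subsets_def)
  then have "{r \<in> Q. touches E C' (B r)} \<subset> Q" by blast
  then have "card {r \<in> Q. touches E C' (B r)} < card Q"
    by (rule psubset_card_mono[OF clique_modelD(1)[OF B(1)]])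
  then show ?thesis
    using B(2) by (intro that[OF enlarged_branch_set_new_branch_set[OF sep C B(1) C' q]]) simp
qed

lemma next_part:
  assumes C: "connected_subset E V C" and att: "attachment f C Q B" "card Q \<le> s" "k \<notin> Q"
    and "1 \<le> q" and free: "\<nexists>M. minor_model (K_star s (Suc q)) V E M"
  obtains X where "X \<subseteq> C" "X \<noteq> {}" "covered W {..<n} q X"
    "\<forall>C'. component E (C - X) C' \<longrightarrow>
      attachable s (override_on f (\<lambda>_. k) X) (insert k Q) C'"
proof -
  have "C \<subseteq> V" using C by (simp add: connected_subset_def)
  have full: "C \<in> full_subsets C Q B" by (rule attached_set_full[OF C att(1)])
  obtain X\<^sub>0 where X\<^sub>0: "separator s C Q B X\<^sub>0" "covered W {..<n} q X\<^sub>0"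
  proof (cases "card Q < s")
    case True
    obtain X where "separator s C Q B X" "covered W {..<n} 1 X"
      by (rule few_branch_sets_separator[OF \<open>C \<subseteq> V\<close> full True])
    then show ?thesis using that covered_mono[OF _ order_refl assms(5)] by blast
  next
    case False
    then have "\<nexists>M. minor_model (K_star (card Q) (Suc q)) V E M" using att(2) free by simp
    then show ?thesis
      by (rule K_star_minor_free_separator[OF \<open>C \<subseteq> V\<close> attachmentD(1)[OF att(1)]]) (rule that)
  qed
  have "finite C" using \<open>C \<subseteq> V\<close> finite_V by (rule finite_subset)
  then obtain X where X: "X \<subseteq> X\<^sub>0" and min: "minimal_separator s C Q B X"
    by (rule minimal_separator_exists[OF _ X\<^sub>0(1)])
  then have sep: "separator s C Q B X" by (simp add: minimal_separator_def)
  have XC: "X \<subseteq> C" "X \<noteq> {}" using sep separator_nonempty[OF full sep] by (auto simp: separator_def)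
  show ?thesis
  proof (rule that[OF XC covered_mono[OF X\<^sub>0(2) X order_refl]], intro allI impI)
    fix C' assume C': "component E (C - X) C'"
    let ?Q = "{r \<in> Q. touches E C' (B r)}"
    obtain D where D: "new_branch_set C' Q B X D" "card ?Q < s"
      by (rule new_branch_set_exists[OF min C attachmentD(1)[OF att(1)] att(2) C'])
    have "attachment (override_on f (\<lambda>_. k) X) C' (insert k ?Q) (B(k := D))"
      by (rule attachment_extend[OF C att(1,3) XC C' D(1)])
    moreover have "card (insert k ?Q) \<le> s" using card_insert_le_m1[of s ?Q k] D(2) by linarith
    moreover have "insert k ?Q \<subseteq> insert k Q" by blast
    ultimately show "attachable s (override_on f (\<lambda>_. k) X) (insert k Q) C'"
      unfolding attachable_def by blast
  qed
qed

text \<open>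
  \<open>f\<close> distributes the set \<open>A\<close> of covered vertices over the parts \<open>0, \<dots>, k - 1\<close>. Every component of the
  uncovered vertices is attached to parts that form a clique in the quotient.
\<close>
definition partial_partition ::
    "nat \<Rightarrow> nat \<Rightarrow> 'a set \<Rightarrow> nat \<Rightarrow> ('a \<Rightarrow> nat) \<Rightarrow> (nat \<Rightarrow> nat set) \<Rightarrow> bool" where
  "partial_partition s q A k f R \<longleftrightarrow>
     A \<subseteq> V \<and> elimination_order s k R \<and> graph_partition E A (order_graph k R) f \<and>
     (\<forall>i<k. covered W {..<n} q {v \<in> A. f v = i}) \<and>
     (\<forall>C. component E (V - A) C \<longrightarrow> (\<exists>p<k. attachable s f (insert p (R p)) C))"

lemma partial_partitionD:
  assumes "partial_partition s q A k f R"
  shows "A \<subseteq> V" "elimination_order s k R" "graph_partition E A (order_graph k R) f"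
    "i < k \<Longrightarrow> covered W {..<n} q {v \<in> A. f v = i}"
    "component E (V - A) C \<Longrightarrow> \<exists>p<k. attachable s f (insert p (R p)) C"
  using assms by (simp_all add: partial_partition_def)

lemma partial_partition_empty: "partial_partition s q {} 1 f (\<lambda>_. {})"
proof -
  have "attachment f C {} B" if "component E V C" for C B
    using componentD(4)[OF that] E_subset by (auto simp: attachment_def clique_model_def)
  then show ?thesis
    by (auto simp: partial_partition_def elimination_order_def graph_partition_def covered_empty
        attachable_def intro!: exI[of _ "{}"])
qed

lemma attachable_after_part:
  assumes P: "partial_partition s q A k f R" and C: "component E (V - A) C"
    and X: "X \<subseteq> C"
    and inner: "\<forall>C'. component E (C - X) C' \<longrightarrow>
      attachable s (override_on f (\<lambda>_. k) X) (insert k Q) C'"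
    and K: "component E (V - (A \<union> X)) K"
  shows "\<exists>p<Suc k. attachable s (override_on f (\<lambda>_. k) X) (insert p ((R(k := Q)) p)) K"
proof -
  have "V - (A \<union> X) = V - A - X" by blast
  then have "component E (V - A - X) K" using K by simp
  then show ?thesis
  proof (rule component_Diff_cases[OF sym_E C X])
    assume "component E (C - X) K"
    then show ?thesis using inner by (intro exI[of _ k]) simp
  next
    assume outside: "component E (V - A) K" "K \<inter> C = {}"
    obtain p Q' B where p: "p < k" "Q' \<subseteq> insert p (R p)" "card Q' \<le> s" and att: "attachment f K Q' B"
      using partial_partitionD(5)[OF P outside(1)] unfolding attachable_def by blast
    have "override_on f (\<lambda>_. k) X y = f y" if "c \<in> K" "(c, y) \<in> E" "y \<notin> K" for c y
    proof -
      have "y \<notin> V - A" using componentD(4)[OF outside(1) that(1,2)] that(3) by blast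
      then have "y \<notin> X" using X componentD(1)[OF C] by blast
      then show ?thesis by simp
    qed
    then have "attachment (override_on f (\<lambda>_. k) X) K Q' B" by (rule attachment_cong[OF att])
    moreover have "Q' \<subseteq> insert p ((R(k := Q)) p)" using p(1,2) by simp
    ultimately have "attachable s (override_on f (\<lambda>_. k) X) (insert p ((R(k := Q)) p)) K"
      using p(3) unfolding attachable_def by blast
    then show ?thesis using p(1) less_SucI by blast
  qed
qed

lemma partial_partition_extend:
  assumes P: "partial_partition s q A k f R" and "A \<noteq> V"
    and "1 \<le> q" and free: "\<nexists>M. minor_model (K_star s (Suc q)) V E M"
  obtains A' f' R' where "A \<subset> A'" "partial_partition s q A' (Suc k) f' R'"
proof -
  note P_props = partial_partitionD[OF P]
  obtain x where "x \<in> V - A" using P_props(1) assms(2) by blast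
  then obtain C where C: "component E (V - A) C"
    using component_containing[OF sym_E finite_Diff[OF finite_V]] by metis
  note C_props = componentD[OF C]
  have connected: "connected_subset E V C" using C_props(1-3) by (auto simp: connected_subset_def)
  obtain p Q B where p: "p < k" "Q \<subseteq> insert p (R p)" "card Q \<le> s" and att: "attachment f C Q B"
    using P_props(5)[OF C] unfolding attachable_def by blast
  have "k \<notin> Q" using p(1,2) elimination_orderD(1)[OF P_props(2) p(1)] by auto
  then obtain X where X: "X \<subseteq> C" "X \<noteq> {}" "covered W {..<n} q X"
    and inner: "\<forall>C'. component E (C - X) C' \<longrightarrow>
      attachable s (override_on f (\<lambda>_. k) X) (insert k Q) C'"
    by (rule next_part[OF connected att p(3) _ assms(3) free])
  let ?f = "override_on f (\<lambda>_. k) X" and ?R = "R(k := Q)"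
  have XA: "X \<inter> A = {}" using X(1) C_props(1) by blast
  have "partial_partition s q (A \<union> X) (Suc k) ?f ?R"
    unfolding partial_partition_def
  proof (intro conjI allI impI)
    show "A \<union> X \<subseteq> V" using P_props(1) X(1) C_props(1) by blast
    show "elimination_order s (Suc k) ?R" by (rule elimination_order_extend[OF P_props(2) p])
    show "graph_partition E (A \<union> X) (order_graph (Suc k) ?R) ?f"
    proof (rule graph_partition_extend[OF sym_E P_props(3) XA])
      show "f v \<in> Q" if "u \<in> X" "v \<in> A" "(u, v) \<in> E" for u v
        using attachmentD(3)[OF att _ that(3)] that(1,2) X(1) C_props(1) by blast
    qed
    show "covered W {..<n} q {v \<in> A \<union> X. ?f v = i}" if "i < Suc k" for i
      by (rule covered_parts_extend[OF P_props(4) X(3) P_props(3) that])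
    show "\<exists>p<Suc k. attachable s ?f (insert p (?R p)) K"
      if "component E (V - (A \<union> X)) K" for K
      by (rule attachable_after_part[OF P C X(1) inner that])
  qed
  moreover have "A \<subset> A \<union> X" using X(2) XA by blast
  ultimately show ?thesis using that by blast
qed

lemma covered_partition_exists:
  assumes "1 \<le> q" "\<nexists>M. minor_model (K_star s (Suc q)) V E M"
  obtains k R f where "elimination_order s k R" "graph_partition E V (order_graph k R) f"
    "\<forall>i<k. covered W {..<n} q {v \<in> V. f v = i}"
proof -
  have "\<exists>k f R. partial_partition s q V k f R"
    if "partial_partition s q A k f R" for A k f R
    using that
  proof (induction "card (V - A)" arbitrary: A k f R rule: less_induct)
    case less
    show ?case
    proof (cases "A = V")
      case True
      then show ?thesis using less.prems by blast
    next
      case False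
      obtain A' f' R' where A': "A \<subset> A'" "partial_partition s q A' (Suc k) f' R'"
        by (rule partial_partition_extend[OF less.prems False assms])
      then have "V - A' \<subset> V - A" using partial_partitionD(1)[OF A'(2)] by blast
      then have "card (V - A') < card (V - A)" using finite_V by (intro psubset_card_mono) auto
      then show ?thesis using less.hyps A'(2) by blast
    qed
  qed
  from this[OF partial_partition_empty]
  obtain k f R where P: "partial_partition s q V k f R" by blast
  have "\<forall>i<k. covered W {..<n} q {v \<in> V. f v = i}"
    using partial_partitionD(4)[OF P] by blast
  with partial_partitionD(2,3)[OF P] show ?thesis by (rule that)
qed

end

section \<open>Tree-decompositions and treewidth\<close>

lemma connected_on_restrict: "connected_on (E \<inter> S \<times> S) S \<longleftrightarrow> connected_on E S"
  using connected_on_edges_mono[of "E \<inter> S \<times> S" S E] connected_on_edges_mono[of E S "E \<inter> S \<times> S"]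
  by auto

lemma symcl_eq: "sym E \<Longrightarrow> E\<^sup>s = E"
  by (auto simp: symcl_def dest: symD)

lemma connected_iff_connected_on:
  assumes "sym (parcs T)"
  shows "Digraph_Component.connected (with_proj T) \<longleftrightarrow>
    pverts T \<noteq> {} \<and> connected_on (parcs T) (pverts T)"
  unfolding connected_conv connected_on_def by (simp add: symcl_eq[OF assms])

lemma connected_induce_iff_connected_on:
  assumes "sym (parcs T)"
  shows "Digraph_Component.connected (with_proj T \<restriction> S) \<longleftrightarrow> S \<noteq> {} \<and> connected_on (parcs T) S"
proof -
  have "arcs_ends (with_proj T \<restriction> S) = parcs T \<inter> S \<times> S" by (auto simp: arcs_ends_conv)
  moreover have "sym (parcs T \<inter> S \<times> S)" using assms by (auto simp: sym_def)
  ultimately have "Digraph_Component.connected (with_proj T \<restriction> S) \<longleftrightarrow>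
      S \<noteq> {} \<and> connected_on (parcs T \<inter> S \<times> S) S"
    unfolding connected_conv connected_on_def by (simp add: symcl_eq)
  then show ?thesis by (simp add: connected_on_restrict)
qed

lemma undirected_tree_not_connected_without_edge:
  assumes T: "undirected_tree T" "(a, b) \<in> parcs T"
    and S: "S \<subseteq> pverts T" "a \<in> S" "b \<in> S"
  shows "\<not> connected_on (parcs T - {(a, b), (b, a)}) S"
proof
  assume connected: "connected_on (parcs T - {(a, b), (b, a)}) S"
  interpret T: pair_graph T using T(1) by (simp add: undirected_tree_def)
  define T' where "T' = \<lparr> pverts = pverts T, parcs = parcs T - {(a, b), (b, a)} \<rparr>"
  interpret T': pair_wf_digraph T'
    by unfold_locales (auto simp: T'_def)
  have "(b, a) \<in> rtrancl_on (pverts T') (parcs T')"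
    using connected_on_rtrancl_on[OF connected S(1,3,2)] by (simp add: T'_def)
  then have "b \<rightarrow>\<^sup>*\<^bsub>with_proj T'\<^esub> a" by (simp add: reachable_def)
  then obtain p where "T'.apath b p a" using T'.reachable_apath by auto
  then have p: "b \<in> pverts T" "set p \<subseteq> parcs T - {(a, b), (b, a)}" "pcas b p a"
      "distinct (pawalk_verts b p)"
    unfolding T'.apath_def T'.awalk_def by (auto simp: T'_def)
  have "T.cycle ((a, b) # p)"
    unfolding T.cycle_def T.awalk_def using p T(2) T.in_arcsD1 by (intro exI[of _ a]) auto
  moreover have "3 \<le> length ((a, b) # p)"
  proof -
    have "p \<noteq> []" using p(3) T.no_loops'[OF T(2)] by auto
    moreover have "p \<noteq> [e]" for e using p(2,3) by (cases e) auto
    ultimately have "2 \<le> length p" by (cases p; cases "tl p") auto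
    then show ?thesis by simp
  qed
  ultimately show False using T(1) unfolding undirected_tree_def by blast
qed

lemma connected_on_enumeration:
  assumes "finite S" "connected_on E S" "S \<noteq> {}"
  obtains xs where "distinct xs" "set xs = S"
    "\<forall>i<length xs. 0 < i \<longrightarrow> (\<exists>j<i. (xs ! j, xs ! i) \<in> E)"
proof -
  obtain x where "x \<in> S" using assms(3) by blast
  let ?P = "\<lambda>D. \<exists>xs. distinct xs \<and> set xs = D \<and>
    (\<forall>i<length xs. 0 < i \<longrightarrow> (\<exists>j<i. (xs ! j, xs ! i) \<in> E))"
  have "?P S"
    using assms(1,2) \<open>x \<in> S\<close>
  proof (rule connected_on_induct[where P = ?P])
    show "?P {x}" by (rule exI[of _ "[x]"]) simp
  next
    fix D u v assume "?P D" and uv: "u \<in> D" "v \<in> S - D" "(u, v) \<in> E"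
    then obtain xs where xs: "distinct xs" "set xs = D"
      and earlier: "\<forall>i<length xs. 0 < i \<longrightarrow> (\<exists>j<i. (xs ! j, xs ! i) \<in> E)" by blast
    obtain k where k: "k < length xs" "xs ! k = u" using uv(1) xs(2) by (auto simp: in_set_conv_nth)
    let ?xs = "xs @ [v]"
    have "\<exists>j<i. (?xs ! j, ?xs ! i) \<in> E" if i: "i < length ?xs" "0 < i" for i
    proof (cases "i = length xs")
      case True
      then show ?thesis using k uv(3) by (intro exI[of _ k]) (simp add: nth_append)
    next
      case False
      then have "i < length xs" using i(1) by simp
      then obtain j where "j < i" "(xs ! j, xs ! i) \<in> E" using earlier i(2) by blast
      then show ?thesis using False i(1) by (intro exI[of _ j]) (simp add: nth_append)
    qed
    moreover have "distinct ?xs" "set ?xs = insert v D" using xs uv(2) by auto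
    ultimately show "?P (insert v D)" by (intro exI[of _ ?xs]) blast
  qed
  then show ?thesis using that by blast
qed

context rooted_tree
begin

lemma subtree_lessThan:
  assumes "i \<le> n"
  shows "subtree {..<i}"
  unfolding subtree_def
proof (intro conjI ballI impI)
  fix a b :: nat assume "a \<in> {..<i}" "b < a"
  then show "parent a \<in> {..<i}" using parent_less[of a] assms by simp
qed (use assms in auto)

lemma pair_graph_tree_graph: "pair_graph tree_graph"
proof (rule pair_graphI)
  show "irrefl (parcs tree_graph)"
  proof (rule irreflI)
    show "(i, i) \<notin> parcs tree_graph" for i using parent_less[of i] by auto
  qed
qed (auto simp: sym_tree_graph)

lemma lower_neighbour_eq_parent:
  assumes "(i, j) \<in> parcs tree_graph \<or> (j, i) \<in> parcs tree_graph" "i \<le> j"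
  shows "i = parent j"
  using assms parent_less[of i] by auto

text \<open>Both neighbours on the cycle of its largest vertex \<open>m\<close> would be the parent of \<open>m\<close>.\<close>
lemma cycle_tree_graph_length:
  assumes "pre_digraph.cycle (with_proj tree_graph) p"
  shows "length p < 3"
proof (rule ccontr)
  assume long: "\<not> length p < 3"
  interpret pair_graph tree_graph by (rule pair_graph_tree_graph)
  have verts: "pawalk_verts u w = u # map snd w" if "awalk u w v" "w \<noteq> []" for u v w
    using that awalk_verts_conv'[of u w v] by (cases w) (auto simp: awalk_def)
  obtain u where u: "awalk u p u" "distinct (tl (pawalk_verts u p))" "p \<noteq> []"
    using assms unfolding cycle_def by blast
  define m where "m = Max (set (pawalk_verts u p))"
  have m: "m \<in> set (pawalk_verts u p)"
    unfolding m_def by (rule Max_in) (simp_all add: verts[OF u(1,3)])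
  obtain q r where qr: "p = q @ r" "awalk u q m" "awalk m r u" using awalk_decomp[OF u(1) m] by blast
  define w where "w = r @ q"
  have cyclic: "awalk m w m" unfolding w_def by (rule awalk_appendI[OF qr(3,2)])
  have distinct: "distinct (map snd w)" using u(2) verts[OF u(1,3)] qr(1) by (auto simp: w_def)
  have le_m: "snd c \<le> m" if "c \<in> set w" for c
  proof -
    have "c \<in> set p" using that qr(1) by (auto simp: w_def)
    then show ?thesis unfolding m_def by (intro Max_ge) (simp_all add: verts[OF u(1,3)])
  qed
  have "3 \<le> length w" using long qr(1) by (simp add: w_def)
  then obtain d ds where d: "w = d # ds" "2 \<le> length ds" by (cases w) auto
  then obtain es e where e: "ds = es @ [e]" by (cases ds rule: rev_cases) auto
  have "es \<noteq> []" using d(2) e by auto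
  have "awalk m (d # es @ [e]) m" using cyclic d(1) e by simp
  then have walk: "fst d = m" "awalk (snd d) es (fst e)" "snd e = m"
      "d \<in> parcs tree_graph" "e \<in> parcs tree_graph"
    by (auto simp: awalk_Cons_iff)
  have "fst e = last (pawalk_verts (snd d) es)" using walk(2) by (auto simp: awalk_def awlast_if_cas)
  then have last: "fst e = snd (last es)"
    using verts[OF walk(2) \<open>es \<noteq> []\<close>] \<open>es \<noteq> []\<close> by (simp add: last_map)
  have "(m, snd d) \<in> parcs tree_graph" using walk(1,4) by (metis prod.collapse)
  moreover have "snd d \<le> m" using le_m d(1) by simp
  ultimately have "snd d = parent m" using lower_neighbour_eq_parent by blast
  have "(fst e, m) \<in> parcs tree_graph" using walk(3,5) by (metis prod.collapse)
  moreover have "fst e \<le> m" using le_m[of "last es"] last d(1) e \<open>es \<noteq> []\<close> by simp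
  ultimately have "fst e = parent m" using lower_neighbour_eq_parent by blast
  then have "snd d = snd (last es)" using \<open>snd d = parent m\<close> last by metis
  then show False using distinct \<open>es \<noteq> []\<close> by (simp add: d(1) e)
qed

lemma undirected_tree_tree_graph:
  assumes "0 < n"
  shows "undirected_tree tree_graph"
proof -
  have "connected_on (parcs tree_graph) {..<n}"
    by (intro subtree_imp_connected_on subtree_lessThan order_refl)
  then have "Digraph_Component.connected (with_proj tree_graph)"
    using assms by (auto simp: connected_iff_connected_on[OF sym_tree_graph])
  moreover have "\<not> (\<exists>p. pre_digraph.cycle (with_proj tree_graph) p \<and> length p \<ge> 3)"
    using cycle_tree_graph_length not_less by blast
  ultimately show ?thesis unfolding undirected_tree_def using pair_graph_tree_graph by blast
qed

end

locale tree_numbering = rooted_tree n parent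
  for n :: nat and parent :: "nat \<Rightarrow> nat" +
  fixes T :: "'b pair_pre_digraph" and g :: "nat \<Rightarrow> 'b"
  assumes undirected_tree: "undirected_tree T"
    and bij_numbering: "bij_betw g {..<n} (pverts T)"
    and parent_edge: "0 < i \<Longrightarrow> i < n \<Longrightarrow> (g (parent i), g i) \<in> parcs T"
begin

lemma sym_T: "sym (parcs T)"
  using undirected_tree pair_graphD(3) by (auto simp: undirected_tree_def)

lemma connected_on_prefix:
  assumes "i \<le> n"
  shows "connected_on (parcs T) (g ` {..<i})"
proof (rule connected_on_image[OF subtree_imp_connected_on[OF subtree_lessThan[OF assms]]])
  fix x y assume "(x, y) \<in> parcs tree_graph"
  then show "(g x, g y) \<in> parcs T" using parent_edge symD[OF sym_T] by auto
qed

lemma subtree_numbers: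
  assumes "N \<subseteq> pverts T" "connected_on (parcs T) N"
  shows "subtree {i. i < n \<and> g i \<in> N}"
proof -
  have "g (parent i) \<in> N" if i: "i < n" "g i \<in> N" and j: "j < n" "g j \<in> N" "j < i" for i j
  proof (rule ccontr)
    assume parent_notin: "g (parent i) \<notin> N"
    let ?P = "g ` {..<i}" and ?E = "parcs T - {(g (parent i), g i), (g i, g (parent i))}"
    have parent: "parent i < i" "(g (parent i), g i) \<in> parcs T"
      using parent_less[of i] parent_edge[of i] i(1) j(3) by auto
    have "g i \<notin> ?P"
      using inj_onD[OF bij_betw_imp_inj_on[OF bij_numbering], of i] i(1) by fastforce
    then have "connected_on ?E ?P"
      using connected_on_edges_mono[OF connected_on_prefix[of i], of ?E] i(1) by auto
    moreover have "connected_on ?E N"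
      using connected_on_edges_mono[OF assms(2), of ?E] parent_notin by auto
    moreover have "sym ?E" using sym_T by (auto simp: sym_def)
    moreover have "N \<inter> ?P \<noteq> {}" using j by auto
    ultimately have "connected_on ?E (N \<union> ?P)" by (intro connected_on_Un) simp_all
    moreover have "N \<union> ?P \<subseteq> pverts T" using assms(1) bij_betwE[OF bij_numbering] i(1) by auto
    ultimately show False
      using undirected_tree_not_connected_without_edge[OF undirected_tree parent(2), of "N \<union> ?P"]
        parent(1) i(2) by blast
  qed
  moreover have "parent i < n" if "i < n" "j < i" for i j using parent_less[of i] that by simp
  ultimately show ?thesis unfolding subtree_def by blast
qed

lemma tree_decomposition_imp_rooted:
  assumes "pair_graph G" "tree_decomposition G T W"
  shows "rooted_tree_decomposition n parent (pverts G) (parcs G) (W \<circ> g)"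
proof -
  note G = pair_graphD[OF assms(1)]
  have number: "\<exists>i<n. g i = x" if "x \<in> pverts T" for x
  proof -
    have "x \<in> g ` {..<n}" using that bij_betw_imp_surj_on[OF bij_numbering] by simp
    then show ?thesis by auto
  qed
  have nodes: "{x \<in> pverts T. v \<in> W x} \<noteq> {}" "connected_on (parcs T) {x \<in> pverts T. v \<in> W x}"
    if "v \<in> pverts G" for v
    using assms(2) that connected_induce_iff_connected_on[OF sym_T]
    by (auto simp: tree_decomposition_def)
  show ?thesis
  proof unfold_locales
    fix u v assume "(u, v) \<in> parcs G"
    then obtain x where "x \<in> pverts T" "u \<in> W x" "v \<in> W x"
      using assms(2) by (auto simp: tree_decomposition_def)
    then show "\<exists>i<n. u \<in> (W \<circ> g) i \<and> v \<in> (W \<circ> g) i" using number by fastforce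
  next
    fix v assume v: "v \<in> pverts G"
    then obtain x where "x \<in> pverts T" "v \<in> W x" using nodes(1) by blast
    then show "\<exists>i<n. v \<in> (W \<circ> g) i" using number by fastforce
    have "{i. i < n \<and> g i \<in> {x \<in> pverts T. v \<in> W x}} = {i. i < n \<and> v \<in> (W \<circ> g) i}"
      using bij_betwE[OF bij_numbering] by auto
    moreover have "subtree {i. i < n \<and> g i \<in> {x \<in> pverts T. v \<in> W x}}"
      by (rule subtree_numbers[OF _ nodes(2)[OF v]]) blast
    ultimately show "subtree {i. i < n \<and> v \<in> (W \<circ> g) i}" by simp
  qed (use G in auto)
qed

end

lemma undirected_tree_numbering:
  assumes "undirected_tree T"
  obtains n parent g where "tree_numbering n parent T g"
proof -
  have "pair_graph T" "Digraph_Component.connected (with_proj T)"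
    using assms by (simp_all add: undirected_tree_def)
  note T = pair_graphD[OF this(1)] and connected = this(2)
  obtain xs where xs: "distinct xs" "set xs = pverts T"
    and "\<forall>i<length xs. 0 < i \<longrightarrow> (\<exists>j<i. (xs ! j, xs ! i) \<in> parcs T)"
    using connected connected_on_enumeration[OF T(1)]
    by (auto simp: connected_iff_connected_on[OF T(3)])
  then obtain parent where parent:
    "\<forall>i<length xs. 0 < i \<longrightarrow> parent i < i \<and> (xs ! parent i, xs ! i) \<in> parcs T"
    by metis
  have "tree_numbering (length xs) parent T ((!) xs)"
    by unfold_locales (use assms parent bij_betw_nth[OF xs(1) HOL.refl xs(2)[symmetric]] in auto)
  then show ?thesis by (rule that)
qed

lemma rooted_tree_decomposition_imp_tree_decomposition:
  assumes "rooted_tree_decomposition n parent (pverts G) (parcs G) W"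
    and "0 < n" "\<And>i. i < n \<Longrightarrow> W i \<subseteq> pverts G"
  shows "tree_decomposition G (rooted_tree.tree_graph n parent) W"
proof -
  interpret rooted_tree_decomposition n parent "pverts G" "parcs G" W by fact
  have "Digraph_Component.connected (with_proj tree_graph \<restriction> {i. i < n \<and> v \<in> W i})"
    if v: "v \<in> pverts G" for v
    using vertex_bag[OF v] subtree_imp_connected_on[OF vertex_subtree[OF v]]
    by (auto simp: connected_induce_iff_connected_on[OF sym_tree_graph])
  moreover have "\<exists>i<n. u \<in> W i \<and> v \<in> W i" if "(u, v) \<in> parcs G" for u v by (rule edge_bag[OF that])
  ultimately show ?thesis
    using undirected_tree_tree_graph[OF assms(2)] assms(3)
    by (auto simp: tree_decomposition_def Bex_def conj_commute)
qed

lemma treewidth_le: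
  fixes T :: "nat pair_pre_digraph"
  assumes "tree_decomposition G T W" "\<And>x. x \<in> pverts T \<Longrightarrow> card (W x) \<le> Suc k"
  shows "treewidth G \<le> int k"
proof -
  have "(LEAST k. \<exists>(T :: nat pair_pre_digraph) W.
      tree_decomposition G T W \<and> (\<forall>x \<in> pverts T. card (W x) \<le> k)) \<le> Suc k"
    by (rule Least_le) (use assms in blast)
  then show ?thesis unfolding treewidth_def by linarith
qed

lemma pair_graph_order_graph:
  assumes "elimination_order s k R"
  shows "pair_graph (order_graph k R)"
proof (rule pair_graphI)
  show "irrefl (parcs (order_graph k R))"
    using elimination_orderD(1)[OF assms] by (force simp: irrefl_def)
qed (auto simp: sym_def)

lemma treewidth_order_graph:
  assumes R: "elimination_order s k R"
  shows "treewidth (order_graph k R) \<le> int s"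
proof -
  let ?H = "order_graph k R" and ?W = "\<lambda>i. insert i (R i)"
  have less: "j < i" if "j \<in> R i" "i < k" for i j
    using elimination_orderD(1)[OF R that(2)] that(1) by auto
  obtain parent where parent: "\<forall>i<k. 0 < i \<longrightarrow> parent i < i \<and> R i \<subseteq> insert (parent i) (R (parent i))"
    using elimination_orderD(3)[OF R] by metis
  interpret rooted_tree k parent by unfold_locales (use parent in simp)
  have "rooted_tree_decomposition k parent (pverts ?H) (parcs ?H) ?W"
  proof unfold_locales
    fix v assume "v \<in> pverts ?H"
    show "subtree {i. i < k \<and> v \<in> ?W i}"
      unfolding subtree_def
    proof (intro conjI ballI impI)
      fix i j assume i: "i \<in> {i. i < k \<and> v \<in> ?W i}" and j: "j \<in> {i. i < k \<and> v \<in> ?W i}" "j < i"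
      have "v \<le> j" using j(1) less[of v j] by auto
      then have "v \<in> R i" using i j(2) by auto
      then show "parent i \<in> {i. i < k \<and> v \<in> ?W i}" using parent i j(2) by auto
    qed auto
  qed (auto simp: sym_def)
  then have "tree_decomposition ?H tree_graph ?W"
  proof (rule rooted_tree_decomposition_imp_tree_decomposition)
    show "0 < k" using R by (simp add: elimination_order_def)
    show "?W i \<subseteq> pverts ?H" if "i < k" for i
      using elimination_orderD(1)[OF R that] that by force
  qed
  moreover have "card (?W i) \<le> Suc s" if "i \<in> pverts tree_graph" for i
    using elimination_orderD(2)[OF R, of i] card_insert_le_m1[of "Suc s" "R i" i] that by simp
  ultimately show ?thesis by (rule treewidth_le)
qed

lemma layered_treewidth_attained:
  fixes G :: "'a pair_pre_digraph"
  assumes "pair_graph G"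
  obtains L and T :: "nat pair_pre_digraph" and W where "layering G L" "tree_decomposition G T W"
    "\<forall>i. \<forall>x\<in>pverts T. card (L i \<inter> W x) \<le> layered_treewidth G"
proof -
  note G = pair_graphD[OF assms]
  let ?P = "\<lambda>k. \<exists>L (T :: nat pair_pre_digraph) W. layering G L \<and> tree_decomposition G T W \<and>
        (\<forall>i. \<forall>x \<in> pverts T. card (L i \<inter> W x) \<le> k)"
  define L where "L i = (if i = (0::nat) then pverts G else {})" for i
  have "layering G L" unfolding layering_def L_def disjoint_family_on_def by auto
  moreover have "tree_decomposition G (rooted_tree.tree_graph (Suc 0) id) (\<lambda>_. pverts G)"
  proof (rule rooted_tree_decomposition_imp_tree_decomposition)
    interpret rooted_tree "Suc 0" id by unfold_locales simp
    show "rooted_tree_decomposition (Suc 0) id (pverts G) (parcs G) (\<lambda>_. pverts G)"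
      by unfold_locales (use G in \<open>auto simp: subtree_def\<close>)
  qed auto
  moreover have "card (L i \<inter> pverts G) \<le> card (pverts G)" for i using G(1) by (simp add: card_mono)
  ultimately have "?P (card (pverts G))" by blast
  then have "?P (layered_treewidth G)" unfolding layered_treewidth_def by (rule LeastI)
  then show ?thesis using that by blast
qed

section \<open>Embeddings into strong products\<close>

lemma strong_product_pverts [simp]: "pverts (A \<boxtimes> B) = pverts A \<times> pverts B"
  by (simp add: strong_product_def)

lemma strong_product_arcI:
  assumes "v \<in> pverts A" "w \<in> pverts A" "x \<in> pverts B" "y \<in> pverts B" "(v, x) \<noteq> (w, y)"
    and "v = w \<or> (v, w) \<in> parcs A" "x = y \<or> (x, y) \<in> parcs B"
  shows "((v, x), (w, y)) \<in> parcs (A \<boxtimes> B)"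
  using assms by (auto simp: strong_product_def)

lemma pair_graph_strong_product:
  assumes "pair_graph A" "pair_graph B"
  shows "pair_graph (A \<boxtimes> B)"
proof (rule pair_graphI)
  note A = pair_graphD[OF assms(1)] and B = pair_graphD[OF assms(2)]
  show "finite (pverts (A \<boxtimes> B))" using A B by simp
  show "parcs (A \<boxtimes> B) \<subseteq> pverts (A \<boxtimes> B) \<times> pverts (A \<boxtimes> B)" by (auto simp: strong_product_def)
  show "sym (parcs (A \<boxtimes> B))" using A(3) B(3) by (auto simp: strong_product_def sym_def)
  show "irrefl (parcs (A \<boxtimes> B))" by (auto simp: strong_product_def irrefl_def)
qed

lemma pair_graph_path_graph: "pair_graph (path_graph n)"
  by (rule pair_graphI) (auto simp: path_graph_def sym_def irrefl_def)

lemma pair_graph_complete_graph: "pair_graph (complete_graph m)"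
  by (rule pair_graphI) (auto simp: complete_graph_def sym_def irrefl_def)

lemma graph_partition_strong_product:
  assumes f: "graph_partition E S A f" and g: "graph_partition E S B g"
  shows "graph_partition E S (A \<boxtimes> B) (\<lambda>v. (f v, g v))"
  unfolding graph_partition_def
proof (intro conjI ballI impI)
  note F = graph_partitionD[OF f] and G = graph_partitionD[OF g]
  show "(f v, g v) \<in> pverts (A \<boxtimes> B)" if "v \<in> S" for v using F(1)[OF that] G(1)[OF that] by simp
  fix u v assume uv: "u \<in> S" "v \<in> S" "(u, v) \<in> E"
  show "(f u, g u) = (f v, g v) \<or> ((f u, g u), (f v, g v)) \<in> parcs (A \<boxtimes> B)"
    using strong_product_arcI[OF F(1)[OF uv(1)] F(1)[OF uv(2)] G(1)[OF uv(1)] G(1)[OF uv(2)] _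
        F(2)[OF uv] G(2)[OF uv]] by blast
qed

lemma graph_partition_iso_to_subgraph:
  fixes G :: "'a pair_pre_digraph"
  assumes G: "pair_graph G" and A: "pair_graph A" and f: "graph_partition (parcs G) (pverts G) A f"
    and small: "\<And>x. x \<in> pverts A \<Longrightarrow> card {v \<in> pverts G. f v = x} \<le> m"
  shows "iso_to_subgraph G (A \<boxtimes> complete_graph m)"
proof -
  note G_props = pair_graphD[OF G] and F = graph_partitionD[OF f]
  let ?C = "\<lambda>x. {v \<in> pverts G. f v = x}"
  have "\<forall>x\<in>pverts A. \<exists>h. h ` ?C x \<subseteq> {..<m} \<and> inj_on h (?C x)"
  proof
    fix x assume "x \<in> pverts A"
    then show "\<exists>h. h ` ?C x \<subseteq> {..<m} \<and> inj_on h (?C x)"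
      using card_le_inj[of "?C x" "{..<m}"] small G_props(1) by simp
  qed
  from bchoice[OF this]
  obtain h where "\<forall>x\<in>pverts A. h x ` ?C x \<subseteq> {..<m} \<and> inj_on (h x) (?C x)" ..
  then have h: "h x ` ?C x \<subseteq> {..<m}" and inj: "inj_on (h x) (?C x)" if "x \<in> pverts A" for x
    using that by simp_all
  define g where "g v = (f v, h (f v) v)" for v
  have colour: "h (f v) v < m" if "v \<in> pverts G" for v using h[OF F(1)[OF that]] that by auto
  have inj_g: "inj_on g (pverts G)"
  proof (rule inj_onI)
    fix u v assume uv: "u \<in> pverts G" "v \<in> pverts G" "g u = g v"
    then have "f u = f v" "h (f v) u = h (f v) v" by (auto simp: g_def)
    then show "u = v" using inj_onD[OF inj[OF F(1)[OF uv(2)]], of u v] uv(1,2) by simp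
  qed
  show ?thesis
  proof (rule iso_to_subgraphI[OF G _ inj_g])
    show "pair_graph (A \<boxtimes> complete_graph m)"
      by (rule pair_graph_strong_product[OF A pair_graph_complete_graph])
    show "g ` pverts G \<subseteq> pverts (A \<boxtimes> complete_graph m)"
      using F(1) colour by (auto simp: g_def complete_graph_def)
    fix u v assume uv: "(u, v) \<in> parcs G"
    have V: "u \<in> pverts G" "v \<in> pverts G" "u \<noteq> v" using uv G_props(2,4) by (auto simp: irrefl_def)
    have "g u \<noteq> g v" using inj_on_eq_iff[OF inj_g V(1,2)] V(3) by simp
    then show "(g u, g v) \<in> parcs (A \<boxtimes> complete_graph m)"
      using F(1)[OF V(1)] F(1)[OF V(2)] F(2)[OF V(1,2) uv] colour[OF V(1)] colour[OF V(2)]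
      unfolding g_def by (intro strong_product_arcI) (auto simp: complete_graph_def)
  qed
qed

lemma layering_imp_path_partition:
  assumes G: "pair_graph G" and L: "layering G L"
  obtains n l where "1 \<le> n" "graph_partition (parcs G) (pverts G) (path_graph n) l"
    "\<forall>v\<in>pverts G. v \<in> L (l v)"
proof -
  note G_props = pair_graphD[OF G]
  have "\<exists>i. v \<in> L i" if "v \<in> pverts G" for v using L that by (auto simp: layering_def)
  then obtain l where l: "\<forall>v\<in>pverts G. v \<in> L (l v)" by metis
  define n where "n = Suc (Max (insert 0 (l ` pverts G)))"
  have less_n: "l v < n" if "v \<in> pverts G" for v
    unfolding n_def using that G_props(1) by (simp add: less_Suc_eq_le)
  have "graph_partition (parcs G) (pverts G) (path_graph n) l"
    unfolding graph_partition_def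
  proof (intro conjI ballI impI)
    show "l v \<in> pverts (path_graph n)" if "v \<in> pverts G" for v
      using less_n[OF that] by (simp add: path_graph_def)
    fix u v assume uv: "u \<in> pverts G" "v \<in> pverts G" "(u, v) \<in> parcs G"
    have "\<bar>int (l u) - int (l v)\<bar> \<le> 1" using L uv(3) l uv(1,2) unfolding layering_def by blast
    then have "l u = l v \<or> l v = Suc (l u) \<or> l u = Suc (l v)" by linarith
    then show "l u = l v \<or> (l u, l v) \<in> parcs (path_graph n)"
      using less_n[OF uv(1)] less_n[OF uv(2)] by (auto simp: path_graph_def)
  qed
  moreover have "1 \<le> n" by (simp add: n_def)
  ultimately show ?thesis using that l by blast
qed

lemma layered_partition_iso_to_subgraph:
  assumes G: "pair_graph G" and L: "layering G L"
    and H: "pair_graph H" and f: "graph_partition (parcs G) (pverts G) H f"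
    and small: "\<And>i j. i \<in> pverts H \<Longrightarrow> card (L j \<inter> {v \<in> pverts G. f v = i}) \<le> m"
  obtains n where "1 \<le> n" "iso_to_subgraph G (H \<boxtimes> path_graph n \<boxtimes> complete_graph m)"
proof -
  obtain n l where "1 \<le> n" and l: "graph_partition (parcs G) (pverts G) (path_graph n) l"
    and layer: "\<forall>v\<in>pverts G. v \<in> L (l v)"
    by (rule layering_imp_path_partition[OF G L])
  have "iso_to_subgraph G (H \<boxtimes> path_graph n \<boxtimes> complete_graph m)"
  proof (rule graph_partition_iso_to_subgraph[OF G])
    show "pair_graph (H \<boxtimes> path_graph n)"
      by (rule pair_graph_strong_product[OF H pair_graph_path_graph])
    show "graph_partition (parcs G) (pverts G) (H \<boxtimes> path_graph n) (\<lambda>v. (f v, l v))"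
      by (rule graph_partition_strong_product[OF f l])
    fix x assume "x \<in> pverts (H \<boxtimes> path_graph n)"
    then obtain i j where x: "x = (i, j)" and "i \<in> pverts H" by auto
    have "card {v \<in> pverts G. (f v, l v) = x} \<le> card (L j \<inter> {v \<in> pverts G. f v = i})"
      using layer pair_graphD(1)[OF G] by (intro card_mono) (auto simp: x)
    also have "\<dots> \<le> m" by (rule small[OF \<open>i \<in> pverts H\<close>])
    finally show "card {v \<in> pverts G. (f v, l v) = x} \<le> m" .
  qed
  with \<open>1 \<le> n\<close> show ?thesis by (rule that)
qed

lemma K_star_minor_free_partition:
  fixes G :: "'a pair_pre_digraph"
  assumes G: "pair_graph G" and td: "tree_decomposition G T W"
    and free: "minor_free (K_star s (Suc q)) G" and "1 \<le> q"
  obtains H :: "nat pair_pre_digraph" and f where "pair_graph H" "treewidth H \<le> int s"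
    "graph_partition (parcs G) (pverts G) H f"
    "\<forall>i\<in>pverts H. covered W (pverts T) q {v \<in> pverts G. f v = i}"
proof -
  have "undirected_tree T" using td by (simp add: tree_decomposition_def)
  then obtain n parent g where "tree_numbering n parent T g" by (rule undirected_tree_numbering)
  then interpret T: tree_numbering n parent T g .
  interpret rooted_tree_decomposition n parent "pverts G" "parcs G" "W \<circ> g"
    by (rule T.tree_decomposition_imp_rooted[OF G td])
  have "\<nexists>M. minor_model (K_star s (Suc q)) (pverts G) (parcs G) M"
    using minor_model_imp_is_minor[OF G pair_graph_K_star] free by blast
  then obtain k R f where R: "elimination_order s k R"
    and f: "graph_partition (parcs G) (pverts G) (order_graph k R) f"
    and cov: "\<forall>i<k. covered (W \<circ> g) {..<n} q {v \<in> pverts G. f v = i}"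
    by (rule covered_partition_exists[OF assms(4)])
  have "\<forall>i\<in>pverts (order_graph k R). covered W (pverts T) q {v \<in> pverts G. f v = i}"
    using cov covered_reindex[of W g "{..<n}"] bij_betw_imp_surj_on[OF T.bij_numbering] by simp
  with pair_graph_order_graph[OF R] treewidth_order_graph[OF R] f show ?thesis by (rule that)
qed

theorem theorem18:
  fixes G :: "'a pair_pre_digraph" and s t :: nat
  assumes "s \<ge> 2" and "t \<ge> 2"
    and "pair_graph G"
    and "minor_free (K_star s t) G"
  shows "\<exists>(H :: nat pair_pre_digraph) n.
           pair_graph H \<and> treewidth H \<le> int s \<and> n \<ge> 1 \<and>
           iso_to_subgraph G
             (H \<boxtimes> path_graph n \<boxtimes> complete_graph ((t - 1) * layered_treewidth G))"
proof -
  have t: "minor_free (K_star s (Suc (t - 1))) G" "1 \<le> t - 1" using assms(2,4) by simp_all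
  obtain L and T :: "nat pair_pre_digraph" and W where L: "layering G L"
    and td: "tree_decomposition G T W"
    and bound: "\<forall>i. \<forall>x\<in>pverts T. card (L i \<inter> W x) \<le> layered_treewidth G"
    by (rule layered_treewidth_attained[OF assms(3)])
  obtain H :: "nat pair_pre_digraph" and f where H: "pair_graph H" "treewidth H \<le> int s"
    and f: "graph_partition (parcs G) (pverts G) H f"
    and cov: "\<forall>i\<in>pverts H. covered W (pverts T) (t - 1) {v \<in> pverts G. f v = i}"
    by (rule K_star_minor_free_partition[OF assms(3) td t])
  have small: "card (L j \<inter> {v \<in> pverts G. f v = i}) \<le> (t - 1) * layered_treewidth G"
    if "i \<in> pverts H" for i j
  proof (rule card_Int_covered_le)
    show "covered W (pverts T) (t - 1) {v \<in> pverts G. f v = i}" using cov that by blast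
    have "L j \<subseteq> pverts G" using L by (auto simp: layering_def)
    then show "finite (L j)" using pair_graphD(1)[OF assms(3)] by (rule finite_subset)
  qed (use bound in blast)
  obtain n where "1 \<le> n" "iso_to_subgraph G
      (H \<boxtimes> path_graph n \<boxtimes> complete_graph ((t - 1) * layered_treewidth G))"
    by (rule layered_partition_iso_to_subgraph[OF assms(3) L H(1) f small])
  then show ?thesis using H by blast
qed

end
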